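(* Let $S,T\in\widehat{\mathcal{C}}_\hbar$ be the invertible elements defining the metric $h(\Phi,\Phi)=S$, $h(\bar\Phi,\bar\Phi)=T$, $h(\Phi,\bar\Phi)=0$ on $\mathcal{X}(\widehat{\mathcal{C}}_\hbar)$, and let $\Delta$ be the corresponding Laplace operator on $\widehat{\mathcal{C}}_\hbar$. Then the elements \begin{align*} X^1&=\tfrac12e^{\hbar/2}\big(RW+R^{-1}W^{-1}+(RW+R^{-1}W^{-1})^*\big),\\ X^2&=-\tfrac i2e^{\hbar/2}\big(RW-R^{-1}W^{-1}-(RW-R^{-1}W^{-1})^*\big),\\ X^3&=U \end{align*} are harmonic, i.e. $\Delta(X^1)=\Delta(X^2)=\Delta(X^3)=0$.
   Context: Let $\hbar\in\mathbb{R}$. $\mathcal{C}_\hbar$ is the unital associative $\mathbb{C}$-algebra with generators $U,R,R^{-1},W,W^{-1}$ and relations $WW^{-1}=W^{-1}W=1$, $RR^{-1}=R^{-1}R=1$, $RU=UR$, $R^{-1}U=UR^{-1}$, $WR=e^{\hbar}RW$, $WR^{-1}=e^{-\hbar}R^{-1}W$, $W^{-1}R=e^{-\hbar}RW^{-1}$, $W^{-1}R^{-1}=e^{\hbar}R^{-1}W^{-1}$, $WU=UW+\hbar W$, $W^{-1}U=UW^{-1}-\hbar W^{-1}$. It is a $*$-algebra via $U^*=U$, $R^*=R$, $W^*=W^{-1}$. Localization: let $Z_\hbar(U,R)$ be the commutative subalgebra generated by $1,U,R,R^{-1}$, let $\phi:Z_\hbar(U,R)\to C^\infty(\mathbb{R})$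 be the algebra homomorphism $\phi(U)=u$, $\phi(R)=e^u$, $\phi(R^{-1})=e^{-u}$, and let $Z^+_\hbar(U,R)=\{p\in Z_\hbar(U,R):|\phi(p)(u)|>0\ \forall u\in\mathbb{R}\}$. $\widehat{\mathcal{C}}_\hbar$ is the universal localization of $\mathcal{C}_\hbar$ at $Z^+_\hbar(U,R)$ (the universal algebra receiving a homomorphism from $\mathcal{C}_\hbar$ under which all elements of $Z_\hbar^+(U,R)$ become invertible); $\mathcal{C}_\hbar$ embeds in it. The involution and derivations of $\mathcal{C}_\hbar$ are extended to $\widehat{\mathcal{C}}_\hbar$. Derivations: $\partial_u,\partial_v$ are the commuting hermitian derivations with $\partial_uU=1$, $\partial_uR=R$, $\partial_uW=0$, $\partial_vU=0$, $\partial_vR=0$, $\partial_vW=iW$. Let $\partial=\frac12(\partial_u-i\partial_v)$, $\bar\partial=\frac12(\partial_u+i\partial_v)$. Module: $e_1,e_2,e_3$ is the canonical basis of the free right module $(\widehat{\mathcal{C}}_\hbar)^3$; $\Phi^1=\frac12e^{\hbar/2}(RW-R^{-1}W^{-1})$, $\Phi^2=-\frac i2e^{\hbar/2}(RW+R^{-1}W^{-1})$, $\Phi^3=1$; $\Phi=\sum_ie_i\Phi^i$, $\bar\Phi=\sum_ie_i(\Phi^i)^*$; $\mathcal{X}(\widehat{\mathcal{C}}_\hbar)$ is the right submodule generated by $\Phi,\bar\Phi$, which is free with basis $\{\Phi,\bar\Phi\}$. The metric $h$ is a hermitian form: additive in the second argument, $h(X,Y)^*=h(Y,X)$, $h(X,Ya)=h(X,Y)a$.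 Operators: for $f\in\widehat{\mathcal{C}}_\hbar$ and $X=\Phi a+\bar\Phi b$ with $a,b\in\widehat{\mathcal{C}}_\hbar$, $\nabla f=\Phi S^{-1}\bar\partial f+\bar\Phi T^{-1}\partial f$, $\operatorname{div}(X)=S^{-1}\partial(Sa)+T^{-1}\bar\partial(Tb)$, $\Delta(f)=\operatorname{div}(\nabla f)$. *)

theory Defs
  imports
    "HOL-Algebra.QuotRing"
    "HOL-Algebra.Module"
    "HOL-Algebra.Generated_Rings"
    "HOL-Library.Poly_Mapping"
    "HOL-Analysis.Finite_Cartesian_Product"
begin

section \<open>Complex algebras by generators and relations\<close>

text \<open>A unital associative complex algebra is represented by a record of type
  \<^typ>\<open>(complex, 'a) module\<close>, i.e. a ring record with a scalar multiplication.
  (The locale \<open>algebra\<close> of HOL-Algebra only covers commutative algebras.)\<close>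

datatype 'g fword = Word (letters: "'g list")

instantiation fword :: (type) monoid_add
begin

definition zero_fword :: "'a fword" where
  "zero_fword = Word []"

definition plus_fword :: "'a fword \<Rightarrow> 'a fword \<Rightarrow> 'a fword" where
  "plus_fword v w = Word (letters v @ letters w)"

instance
  by standard (simp_all add: zero_fword_def plus_fword_def)

end

text \<open>Since the sum of words is concatenation, the convolution product of
  \<^typ>\<open>'g fword \<Rightarrow>\<^sub>0 complex\<close> makes it the free (noncommutative) algebra on \<^typ>\<open>'g\<close>.\<close>

type_synonym 'g falg = "'g fword \<Rightarrow>\<^sub>0 complex"

definition letter :: "'g \<Rightarrow> 'g falg" where
  "letter g = Poly_Mapping.single (Word [g]) 1"

definition const :: "complex \<Rightarrow> 'g falg" where
  "const c = Poly_Mapping.single 0 c"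

definition free_algebra :: "'g set \<Rightarrow> 'g falg ring" where
  "free_algebra X =
     \<lparr>carrier = {p. \<forall>w \<in> Poly_Mapping.keys p. set (letters w) \<subseteq> X},
      mult = (*), one = 1, zero = 0, add = (+)\<rparr>"

definition relation_ideal :: "'g set \<Rightarrow> ('g falg \<times> 'g falg) set \<Rightarrow> 'g falg set" where
  "relation_ideal X rel = genideal (free_algebra X) {p - q |p q. (p, q) \<in> rel}"

definition alg_class :: "'g set \<Rightarrow> ('g falg \<times> 'g falg) set \<Rightarrow> 'g falg \<Rightarrow> 'g falg set" where
  "alg_class X rel p = relation_ideal X rel +>\<^bsub>free_algebra X\<^esub> p"

definition presented_algebra ::
    "'g set \<Rightarrow> ('g falg \<times> 'g falg) set \<Rightarrow> (complex, 'g falg set) module" where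
  "presented_algebra X rel =
     (let Q = free_algebra X Quot relation_ideal X rel in
      \<lparr>carrier = carrier Q, mult = mult Q, one = one Q, zero = zero Q, add = add Q,
       smult = (\<lambda>c x. alg_class X rel (const c) \<otimes>\<^bsub>Q\<^esub> x)\<rparr>)"

definition algebra_hom ::
    "(complex, 'a) module \<Rightarrow> (complex, 'b) module \<Rightarrow> ('a \<Rightarrow> 'b) set" where
  "algebra_hom A B =
     {f \<in> ring_hom A B. \<forall>c. \<forall>x \<in> carrier A. f (c \<odot>\<^bsub>A\<^esub> x) = c \<odot>\<^bsub>B\<^esub> f x}"

definition generated_subalgebra :: "(complex, 'a) module \<Rightarrow> 'a set \<Rightarrow> 'a set" where
  "generated_subalgebra A H = generate_ring A (H \<union> range (\<lambda>c. c \<odot>\<^bsub>A\<^esub> \<one>\<^bsub>A\<^esub>))"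


section \<open>Universal localization\<close>

text \<open>The universal localization of the algebra presented by \<open>X\<close> and \<open>rel\<close> at a set \<open>\<Sigma>\<close> of
  its elements is obtained by adjoining, for every \<open>s \<in> \<Sigma>\<close>, a free generator \<open>Inv s\<close>
  subject to \<open>s (Inv s) = (Inv s) s = 1\<close>. The elements of \<open>\<Sigma>\<close> are cosets; the relations are
  imposed for every representative \<open>p\<close> of \<open>s\<close>, and modulo the images of \<open>rel\<close> they do not
  depend on \<open>p\<close>.\<close>

datatype 'g loc_letter = Gen 'g | Inv "'g falg set"

definition embed :: "'g falg \<Rightarrow> 'g loc_letter falg" where
  "embed p = (\<Sum>w \<in> Poly_Mapping.keys p.
     Poly_Mapping.single (Word (map Gen (letters w))) (Poly_Mapping.lookup p w))"

definition loc_letters :: "'g set \<Rightarrow> 'g falg set set \<Rightarrow> 'g loc_letter set" where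
  "loc_letters X \<Sigma> = Gen ` X \<union> Inv ` \<Sigma>"

definition loc_relations ::
    "('g falg \<times> 'g falg) set \<Rightarrow> 'g falg set set \<Rightarrow> ('g loc_letter falg \<times> 'g loc_letter falg) set" where
  "loc_relations rel \<Sigma> =
     {(embed p, embed q) |p q. (p, q) \<in> rel} \<union>
     {(embed p * letter (Inv s), 1) |p s. s \<in> \<Sigma> \<and> p \<in> s} \<union>
     {(letter (Inv s) * embed p, 1) |p s. s \<in> \<Sigma> \<and> p \<in> s}"

definition universal_localization ::
    "'g set \<Rightarrow> ('g falg \<times> 'g falg) set \<Rightarrow> 'g falg set set \<Rightarrow>
     (complex, 'g loc_letter falg set) module" where
  "universal_localization X rel \<Sigma> = presented_algebra (loc_letters X \<Sigma>) (loc_relations rel \<Sigma>)"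


section \<open>The algebra C with parameter hbar\<close>

text \<open>\<open>gRi\<close> and \<open>gWi\<close> stand for the generators $R^{-1}$ and $W^{-1}$.\<close>

datatype cat_gen = gU | gR | gRi | gW | gWi

definition cat_relations :: "real \<Rightarrow> (cat_gen falg \<times> cat_gen falg) set" where
  "cat_relations hbar =
     (let U = letter gU; R = letter gR; Ri = letter gRi; W = letter gW; Wi = letter gWi;
          q = const (complex_of_real (exp hbar)); qi = const (complex_of_real (exp (- hbar)));
          h = const (complex_of_real hbar)
      in {(W * Wi, 1), (Wi * W, 1), (R * Ri, 1), (Ri * R, 1),
          (R * U, U * R), (Ri * U, U * Ri),
          (W * R, q * R * W), (W * Ri, qi * Ri * W),
          (Wi * R, qi * R * Wi), (Wi * Ri, q * Ri * Wi),
          (W * U, U * W + h * W), (Wi * U, U * Wi - h * Wi)})"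

definition Cat :: "real \<Rightarrow> (complex, cat_gen falg set) module" where
  "Cat hbar = presented_algebra UNIV (cat_relations hbar)"

definition cat :: "real \<Rightarrow> cat_gen \<Rightarrow> cat_gen falg set" where
  "cat hbar g = alg_class UNIV (cat_relations hbar) (letter g)"

definition ZUR :: "real \<Rightarrow> cat_gen falg set set" where
  "ZUR hbar = generated_subalgebra (Cat hbar) {cat hbar gU, cat hbar gR, cat hbar gRi}"

definition smooth :: "(real \<Rightarrow> complex) \<Rightarrow> bool" where
  "smooth f \<longleftrightarrow> (\<exists>D. D 0 = f \<and> (\<forall>n x. (D n has_vector_derivative D (Suc n) x) (at x)))"

definition Cinf :: "(complex, real \<Rightarrow> complex) module" where
  "Cinf = \<lparr>carrier = {f. smooth f},
     mult = (\<lambda>f g u. f u * g u), one = (\<lambda>u. 1), zero = (\<lambda>u. 0), add = (\<lambda>f g u. f u + g u),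
     smult = (\<lambda>c f u. c * f u)\<rparr>"

text \<open>The homomorphism \<open>\<phi>\<close> is determined by its values on the generators of \<open>ZUR hbar\<close>; as a
  total function it is made unique by being \<^const>\<open>extensional\<close>, and likewise below.\<close>

definition phi :: "real \<Rightarrow> cat_gen falg set \<Rightarrow> real \<Rightarrow> complex" where
  "phi hbar = (THE \<phi>. \<phi> \<in> extensional (ZUR hbar) \<and> \<phi> \<in> algebra_hom (Cat hbar\<lparr>carrier := ZUR hbar\<rparr>) Cinf \<and>
     \<phi> (cat hbar gU) = (\<lambda>u. complex_of_real u) \<and>
     \<phi> (cat hbar gR) = (\<lambda>u. complex_of_real (exp u)) \<and>
     \<phi> (cat hbar gRi) = (\<lambda>u. complex_of_real (exp (- u))))"

definition Zplus :: "real \<Rightarrow> cat_gen falg set set" where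
  "Zplus hbar = {p \<in> ZUR hbar. \<forall>u. cmod (phi hbar p u) > 0}"


section \<open>The localized algebra, its involution and derivations\<close>

type_synonym hat = "cat_gen loc_letter falg set"

definition Hat :: "real \<Rightarrow> (complex, hat) module" where
  "Hat hbar = universal_localization UNIV (cat_relations hbar) (Zplus hbar)"

definition hgen :: "real \<Rightarrow> cat_gen \<Rightarrow> hat" where
  "hgen hbar g = alg_class (loc_letters UNIV (Zplus hbar))
     (loc_relations (cat_relations hbar) (Zplus hbar)) (letter (Gen g))"

definition involution :: "(complex, 'a) module \<Rightarrow> ('a \<Rightarrow> 'a) \<Rightarrow> bool" where
  "involution A s \<longleftrightarrow> s \<in> carrier A \<rightarrow> carrier A \<and>
     (\<forall>x \<in> carrier A. \<forall>y \<in> carrier A. s (x \<oplus>\<^bsub>A\<^esub> y) = s x \<oplus>\<^bsub>A\<^esub> s y) \<and>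
     (\<forall>x \<in> carrier A. \<forall>y \<in> carrier A. s (x \<otimes>\<^bsub>A\<^esub> y) = s y \<otimes>\<^bsub>A\<^esub> s x) \<and>
     (\<forall>c. \<forall>x \<in> carrier A. s (c \<odot>\<^bsub>A\<^esub> x) = cnj c \<odot>\<^bsub>A\<^esub> s x) \<and>
     (\<forall>x \<in> carrier A. s (s x) = x)"

definition derivation :: "(complex, 'a) module \<Rightarrow> ('a \<Rightarrow> 'a) \<Rightarrow> bool" where
  "derivation A d \<longleftrightarrow> d \<in> carrier A \<rightarrow> carrier A \<and>
     (\<forall>x \<in> carrier A. \<forall>y \<in> carrier A. d (x \<oplus>\<^bsub>A\<^esub> y) = d x \<oplus>\<^bsub>A\<^esub> d y) \<and>
     (\<forall>c. \<forall>x \<in> carrier A. d (c \<odot>\<^bsub>A\<^esub> x) = c \<odot>\<^bsub>A\<^esub> d x) \<and>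
     (\<forall>x \<in> carrier A. \<forall>y \<in> carrier A.
        d (x \<otimes>\<^bsub>A\<^esub> y) = (d x \<otimes>\<^bsub>A\<^esub> y) \<oplus>\<^bsub>A\<^esub> (x \<otimes>\<^bsub>A\<^esub> d y))"

definition hermitian_map :: "(complex, 'a) module \<Rightarrow> ('a \<Rightarrow> 'a) \<Rightarrow> ('a \<Rightarrow> 'a) \<Rightarrow> bool" where
  "hermitian_map A s d \<longleftrightarrow> (\<forall>x \<in> carrier A. d (s x) = s (d x))"

text \<open>A \<open>*\<close>-structure or a derivation on the localized algebra is determined by its values
  on \<open>U, R, W\<close>, because it is forced on inverses; so \<open>star\<close> and \<open>partials\<close> are the unique
  extensions of the ones on the unlocalized algebra.\<close>

definition star :: "real \<Rightarrow> hat \<Rightarrow> hat" where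
  "star hbar = (THE s. s \<in> extensional (carrier (Hat hbar)) \<and> involution (Hat hbar) s \<and>
     s (hgen hbar gU) = hgen hbar gU \<and> s (hgen hbar gR) = hgen hbar gR \<and> s (hgen hbar gW) = hgen hbar gWi)"

definition partials :: "real \<Rightarrow> (hat \<Rightarrow> hat) \<times> (hat \<Rightarrow> hat)" where
  "partials hbar = (THE d. case d of (du, dv) \<Rightarrow>
     du \<in> extensional (carrier (Hat hbar)) \<and> dv \<in> extensional (carrier (Hat hbar)) \<and>
     derivation (Hat hbar) du \<and> derivation (Hat hbar) dv \<and>
     hermitian_map (Hat hbar) (star hbar) du \<and> hermitian_map (Hat hbar) (star hbar) dv \<and>
     (\<forall>x \<in> carrier (Hat hbar). du (dv x) = dv (du x)) \<and>
     du (hgen hbar gU) = \<one>\<^bsub>Hat hbar\<^esub> \<and> du (hgen hbar gR) = hgen hbar gR \<and> du (hgen hbar gW) = \<zero>\<^bsub>Hat hbar\<^esub> \<and>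
     dv (hgen hbar gU) = \<zero>\<^bsub>Hat hbar\<^esub> \<and> dv (hgen hbar gR) = \<zero>\<^bsub>Hat hbar\<^esub> \<and>
     dv (hgen hbar gW) = \<i> \<odot>\<^bsub>Hat hbar\<^esub> hgen hbar gW)"

definition partial_u :: "real \<Rightarrow> hat \<Rightarrow> hat" where
  "partial_u hbar = fst (partials hbar)"

definition partial_v :: "real \<Rightarrow> hat \<Rightarrow> hat" where
  "partial_v hbar = snd (partials hbar)"

definition del :: "real \<Rightarrow> hat \<Rightarrow> hat" where
  "del hbar f = (1/2) \<odot>\<^bsub>Hat hbar\<^esub> (partial_u hbar f \<ominus>\<^bsub>Hat hbar\<^esub> (\<i> \<odot>\<^bsub>Hat hbar\<^esub> partial_v hbar f))"

definition delbar :: "real \<Rightarrow> hat \<Rightarrow> hat" where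
  "delbar hbar f = (1/2) \<odot>\<^bsub>Hat hbar\<^esub> (partial_u hbar f \<oplus>\<^bsub>Hat hbar\<^esub> (\<i> \<odot>\<^bsub>Hat hbar\<^esub> partial_v hbar f))"


section \<open>The module of vector fields and the Laplace operator\<close>

text \<open>An element $\sum_i e_i X^i$ of the free right module of rank 3 is the vector of its
  coordinates \<open>X $ i\<close>.\<close>

definition vadd :: "real \<Rightarrow> hat^3 \<Rightarrow> hat^3 \<Rightarrow> hat^3" where
  "vadd hbar X Y = (\<chi> i. X $ i \<oplus>\<^bsub>Hat hbar\<^esub> Y $ i)"

definition vright :: "real \<Rightarrow> hat^3 \<Rightarrow> hat \<Rightarrow> hat^3" where
  "vright hbar X a = (\<chi> i. X $ i \<otimes>\<^bsub>Hat hbar\<^esub> a)"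

definition RW :: "real \<Rightarrow> hat" where
  "RW hbar = hgen hbar gR \<otimes>\<^bsub>Hat hbar\<^esub> hgen hbar gW"

definition RiWi :: "real \<Rightarrow> hat" where
  "RiWi hbar = hgen hbar gRi \<otimes>\<^bsub>Hat hbar\<^esub> hgen hbar gWi"

definition Phi :: "real \<Rightarrow> hat^3" where
  "Phi hbar = (\<chi> i.
     if i = 1 then (1/2 * complex_of_real (exp (hbar/2))) \<odot>\<^bsub>Hat hbar\<^esub> (RW hbar \<ominus>\<^bsub>Hat hbar\<^esub> RiWi hbar)
     else if i = 2 then (- \<i>/2 * complex_of_real (exp (hbar/2))) \<odot>\<^bsub>Hat hbar\<^esub> (RW hbar \<oplus>\<^bsub>Hat hbar\<^esub> RiWi hbar)
     else \<one>\<^bsub>Hat hbar\<^esub>)"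

definition Phibar :: "real \<Rightarrow> hat^3" where
  "Phibar hbar = (\<chi> i. star hbar (Phi hbar $ i))"

definition combination :: "real \<Rightarrow> hat \<Rightarrow> hat \<Rightarrow> hat^3" where
  "combination hbar a b = vadd hbar (vright hbar (Phi hbar) a) (vright hbar (Phibar hbar) b)"

definition vfields :: "real \<Rightarrow> (hat^3) set" where
  "vfields hbar = {combination hbar a b |a b. a \<in> carrier (Hat hbar) \<and> b \<in> carrier (Hat hbar)}"

definition hermitian_form :: "real \<Rightarrow> (hat^3 \<Rightarrow> hat^3 \<Rightarrow> hat) \<Rightarrow> bool" where
  "hermitian_form hbar h \<longleftrightarrow>
     (\<forall>X \<in> vfields hbar. \<forall>Y \<in> vfields hbar. h X Y \<in> carrier (Hat hbar)) \<and>
     (\<forall>X \<in> vfields hbar. \<forall>Y \<in> vfields hbar. \<forall>Y' \<in> vfields hbar.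
        h X (vadd hbar Y Y') = h X Y \<oplus>\<^bsub>Hat hbar\<^esub> h X Y') \<and>
     (\<forall>X \<in> vfields hbar. \<forall>Y \<in> vfields hbar. star hbar (h X Y) = h Y X) \<and>
     (\<forall>X \<in> vfields hbar. \<forall>Y \<in> vfields hbar. \<forall>a \<in> carrier (Hat hbar).
        h X (vright hbar Y a) = h X Y \<otimes>\<^bsub>Hat hbar\<^esub> a)"

text \<open>\<open>{\<Phi>, \<Phi>bar}\<close> is a basis, so the coordinates are well defined.\<close>

definition coords :: "real \<Rightarrow> hat^3 \<Rightarrow> hat \<times> hat" where
  "coords hbar X = (THE ab. ab \<in> carrier (Hat hbar) \<times> carrier (Hat hbar) \<and>
     X = combination hbar (fst ab) (snd ab))"

definition gradient :: "real \<Rightarrow> hat \<Rightarrow> hat \<Rightarrow> hat \<Rightarrow> hat^3" where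
  "gradient hbar S T f = combination hbar
     (inv\<^bsub>Hat hbar\<^esub> S \<otimes>\<^bsub>Hat hbar\<^esub> delbar hbar f) (inv\<^bsub>Hat hbar\<^esub> T \<otimes>\<^bsub>Hat hbar\<^esub> del hbar f)"

definition divergence :: "real \<Rightarrow> hat \<Rightarrow> hat \<Rightarrow> hat^3 \<Rightarrow> hat" where
  "divergence hbar S T X = (case coords hbar X of (a, b) \<Rightarrow>
     (inv\<^bsub>Hat hbar\<^esub> S \<otimes>\<^bsub>Hat hbar\<^esub> del hbar (S \<otimes>\<^bsub>Hat hbar\<^esub> a)) \<oplus>\<^bsub>Hat hbar\<^esub>
     (inv\<^bsub>Hat hbar\<^esub> T \<otimes>\<^bsub>Hat hbar\<^esub> delbar hbar (T \<otimes>\<^bsub>Hat hbar\<^esub> b)))"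

definition Laplace :: "real \<Rightarrow> hat \<Rightarrow> hat \<Rightarrow> hat \<Rightarrow> hat" where
  "Laplace hbar S T f = divergence hbar S T (gradient hbar S T f)"

definition X1 :: "real \<Rightarrow> hat" where
  "X1 hbar = (1/2 * complex_of_real (exp (hbar/2))) \<odot>\<^bsub>Hat hbar\<^esub>
     ((RW hbar \<oplus>\<^bsub>Hat hbar\<^esub> RiWi hbar) \<oplus>\<^bsub>Hat hbar\<^esub> star hbar (RW hbar \<oplus>\<^bsub>Hat hbar\<^esub> RiWi hbar))"

definition X2 :: "real \<Rightarrow> hat" where
  "X2 hbar = (- \<i>/2 * complex_of_real (exp (hbar/2))) \<odot>\<^bsub>Hat hbar\<^esub>
     ((RW hbar \<ominus>\<^bsub>Hat hbar\<^esub> RiWi hbar) \<ominus>\<^bsub>Hat hbar\<^esub> star hbar (RW hbar \<ominus>\<^bsub>Hat hbar\<^esub> RiWi hbar))"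

definition X3 :: "real \<Rightarrow> hat" where
  "X3 hbar = hgen hbar gU"

end

theory Submission
  imports Defs
begin

text \<open>The Laplace operator does not see the metric: with \<open>a = S\<^sup>-\<^sup>1 \<partial>bar f\<close> and
  \<open>b = T\<^sup>-\<^sup>1 \<partial> f\<close> it sends \<open>f\<close> to \<open>S\<^sup>-\<^sup>1 \<partial> \<partial>bar f + T\<^sup>-\<^sup>1 \<partial>bar \<partial> f\<close>, and
  \<open>4 \<partial> \<partial>bar = \<partial>\<^sub>u\<^sup>2 + \<partial>\<^sub>v\<^sup>2\<close> annihilates \<open>U\<close>, \<open>R W\<close>, \<open>R\<^sup>-\<^sup>1 W\<^sup>-\<^sup>1\<close> and commutes with the involution.
  The substance is that the objects defined by description exist and are unique. Existence comes from
  universal properties: \<open>\<phi>\<close> from the representation of \<open>C\<close> by multiplication and shift operators on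
  functions, the involution from a homomorphism into the conjugate opposite algebra, the derivations
  from homomorphisms into the dual numbers. Uniqueness holds because the localized algebra is generated by
  \<open>U, R, W\<close> under sums, products and inverses.\<close>

section \<open>Noncommutative complex algebras\<close>

text \<open>Using a universal property of the localization has a price: elements of
  \<open>Zplus\<close> must be shown to go to units. For the involution, the image of
  \<open>s\<close> comes from an element of \<open>ZUR\<close> whose function is the complex
  conjugate of that of \<open>s\<close>, so it has no zeros either. For the derivations, a dual
  number is a unit as soon as its first component is one. A second obstacle is
  \<open>coords\<close>: the divergence reads off the coefficients of a vector field, so
  \<open>Phi\<close> and \<open>Phibar\<close> must be independent. This comes down to inverting R +
  e^{-hbar} R^{-1}, whose function e^u + e^{-hbar-u} is positive; the constant stems from W R^{-1} =
  e^{-hbar} R^{-1} W. The final cancellation is 1 + i^2 = 0, the squares of the weights of R W under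
  the two partial derivatives.\<close>

locale complex_algebra = ring A for A :: "(complex, 'a) module" (structure) +
  assumes smult_closed [simp, intro]: "x \<in> carrier A \<Longrightarrow> c \<odot> x \<in> carrier A"
    and smult_l_distr: "x \<in> carrier A \<Longrightarrow> (c + d) \<odot> x = c \<odot> x \<oplus> d \<odot> x"
    and smult_r_distr: "x \<in> carrier A \<Longrightarrow> y \<in> carrier A \<Longrightarrow> c \<odot> (x \<oplus> y) = c \<odot> x \<oplus> c \<odot> y"
    and smult_smult [simp]: "x \<in> carrier A \<Longrightarrow> c \<odot> (d \<odot> x) = (c * d) \<odot> x"
    and smult_one [simp]: "x \<in> carrier A \<Longrightarrow> 1 \<odot> x = x"
    and smult_mult_left: "x \<in> carrier A \<Longrightarrow> y \<in> carrier A \<Longrightarrow> (c \<odot> x) \<otimes> y = c \<odot> (x \<otimes> y)"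
    and smult_mult_right: "x \<in> carrier A \<Longrightarrow> y \<in> carrier A \<Longrightarrow> x \<otimes> (c \<odot> y) = c \<odot> (x \<otimes> y)"
begin

lemma smult_zero_left [simp]: "x \<in> carrier A \<Longrightarrow> 0 \<odot> x = \<zero>"
  using smult_l_distr[of x 0 0] by (metis add.l_cancel_one' add_0_left smult_closed)

lemma smult_zero_right [simp]: "c \<odot> \<zero> = \<zero>"
  using smult_r_distr[of \<zero> \<zero> c] by (metis add.l_cancel_one' local.add.one_closed local.add.r_one smult_closed)

lemma smult_uminus: "x \<in> carrier A \<Longrightarrow> (- c) \<odot> x = \<ominus> (c \<odot> x)"
  by (metis add.inv_equality add.left_inverse smult_closed smult_l_distr smult_zero_left)

lemma smult_minus_right: "x \<in> carrier A \<Longrightarrow> c \<odot> (\<ominus> x) = \<ominus> (c \<odot> x)"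
  by (metis add.inv_equality add.inv_closed l_neg smult_closed smult_r_distr smult_zero_right)

lemma uminus_eq_smult: "x \<in> carrier A \<Longrightarrow> \<ominus> x = (-1) \<odot> x"
  by (simp add: smult_uminus)

end

subsection \<open>Evaluation of free algebras\<close>

text \<open>Letters whose value lies outside the carrier are sent to zero; this makes evaluation
  total, so that no side conditions on the assignment are needed.\<close>

definition letter_value :: "(complex, 'b) module \<Rightarrow> ('g \<Rightarrow> 'b) \<Rightarrow> 'g \<Rightarrow> 'b" where
  "letter_value B f g = (if f g \<in> carrier B then f g else \<zero>\<^bsub>B\<^esub>)"

definition word_value :: "(complex, 'b) module \<Rightarrow> ('g \<Rightarrow> 'b) \<Rightarrow> 'g fword \<Rightarrow> 'b" where
  "word_value B f w = foldr (\<lambda>g x. letter_value B f g \<otimes>\<^bsub>B\<^esub> x) (letters w) \<one>\<^bsub>B\<^esub>"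

definition falg_value :: "(complex, 'b) module \<Rightarrow> ('g \<Rightarrow> 'b) \<Rightarrow> 'g falg \<Rightarrow> 'b" where
  "falg_value B f p = (\<Oplus>\<^bsub>B\<^esub>w\<in>Poly_Mapping.keys p. Poly_Mapping.lookup p w \<odot>\<^bsub>B\<^esub> word_value B f w)"

lemma sum_singles: "(\<Sum>w\<in>Poly_Mapping.keys p. Poly_Mapping.single w (Poly_Mapping.lookup p w)) = p"
  by (rule poly_mapping_eqI)
    (simp add: Poly_Mapping.lookup_sum lookup_single when_def in_keys_iff)

text \<open>Every element is the finite sum of its monomials, so additive statements need checking
  on monomials only. Going through subsets \<open>K\<close> of the support keeps the letters of each
  monomial inside \<open>X\<close>.\<close>

lemma falg_induct [consumes 1, case_names zero single add]:
  fixes p :: "'g falg"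
  assumes "p \<in> carrier (free_algebra X)"
    and "P 0"
    and single: "\<And>w c. set (letters w) \<subseteq> X \<Longrightarrow> P (Poly_Mapping.single w c)"
    and add: "\<And>p q. P p \<Longrightarrow> P q \<Longrightarrow> P (p + q)"
  shows "P p"
proof -
  have "P (\<Sum>w\<in>K. Poly_Mapping.single w (Poly_Mapping.lookup p w))"
    if "finite K" "K \<subseteq> Poly_Mapping.keys p" for K
    using that
  proof (induction K)
    case (insert w K)
    then show ?case
      using assms(1) by (auto intro!: add single simp: free_algebra_def)
  qed (use assms(2) in simp)
  from this[of "Poly_Mapping.keys p"] show ?thesis
    by (simp add: sum_singles)
qed

lemma falg_induct_UNIV [case_names zero single add]:
  fixes p :: "'g falg"
  assumes "P 0" "\<And>w c. P (Poly_Mapping.single w c)" "\<And>p q. P p \<Longrightarrow> P q \<Longrightarrow> P (p + q)"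
  shows "P p"
  by (rule falg_induct[of p UNIV]) (use assms in \<open>auto simp: free_algebra_def\<close>)

context complex_algebra
begin

lemma letter_value_closed [simp]: "letter_value A f g \<in> carrier A"
  by (simp add: letter_value_def)

lemma letter_value_eq [simp]: "f g \<in> carrier A \<Longrightarrow> letter_value A f g = f g"
  by (simp add: letter_value_def)

lemma foldr_word_closed:
  "z \<in> carrier A \<Longrightarrow> foldr (\<lambda>g x. letter_value A f g \<otimes> x) ws z \<in> carrier A"
  by (induction ws) auto

lemma word_value_closed [simp]: "word_value A f w \<in> carrier A"
  by (simp add: word_value_def foldr_word_closed)

lemma word_value_add: "word_value A f (v + w) = word_value A f v \<otimes> word_value A f w"
proof -
  \<comment> \<open>Concatenation makes the value of the second word the start value of the fold
    over the first, so the induction has to allow an arbitrary start value \<open>z\<close>.\<close>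
  have "foldr (\<lambda>g x. letter_value A f g \<otimes> x) vs z =
      foldr (\<lambda>g x. letter_value A f g \<otimes> x) vs \<one> \<otimes> z" if "z \<in> carrier A" for vs z
    using that by (induction vs) (auto simp: m_assoc foldr_word_closed)
  from this[OF word_value_closed] show ?thesis
    by (simp add: word_value_def plus_fword_def)
qed

lemma word_value_zero [simp]: "word_value A f 0 = \<one>"
  by (simp add: word_value_def zero_fword_def)

lemma word_value_letter [simp]: "word_value A f (Word [g]) = letter_value A f g"
  by (simp add: word_value_def)

lemma falg_value_closed [simp]: "falg_value A f p \<in> carrier A"
  by (auto simp: falg_value_def)

text \<open>The support of a sum can shrink by cancellation, so the values of \<open>p\<close>,
  \<open>q\<close> and \<open>p + q\<close> are compared as sums over one common finite set; the
  extra terms have coefficient 0.\<close>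

lemma falg_value_superset:
  assumes "finite K" "Poly_Mapping.keys p \<subseteq> K"
  shows "falg_value A f p = (\<Oplus>w\<in>K. Poly_Mapping.lookup p w \<odot> word_value A f w)"
  unfolding falg_value_def
  by (rule add.finprod_mono_neutral_cong_left) (use assms in \<open>auto simp: in_keys_iff\<close>)

lemma falg_value_add: "falg_value A f (p + q) = falg_value A f p \<oplus> falg_value A f q"
proof -
  let ?K = "Poly_Mapping.keys p \<union> Poly_Mapping.keys q"
  have *: "finite ?K" "Poly_Mapping.keys (p + q) \<subseteq> ?K" "Poly_Mapping.keys p \<subseteq> ?K"
    "Poly_Mapping.keys q \<subseteq> ?K"
    by (auto simp: Poly_Mapping.keys_add)
  show ?thesis
    by (simp add: falg_value_superset[OF *(1,2)] falg_value_superset[OF *(1,3)]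
        falg_value_superset[OF *(1,4)] Poly_Mapping.lookup_add smult_l_distr add.finprod_multf)
qed

lemma falg_value_zero [simp]: "falg_value A f 0 = \<zero>"
  by (simp add: falg_value_def)

lemma falg_value_single [simp]:
  "falg_value A f (Poly_Mapping.single w c) = c \<odot> word_value A f w"
  by (cases "c = 0") (simp_all add: falg_value_def)

lemma falg_value_letter [simp]: "falg_value A f (letter g) = letter_value A f g"
  by (simp add: letter_def)

lemma falg_value_const [simp]: "falg_value A f (const c) = c \<odot> \<one>"
  by (simp add: const_def)

lemma falg_value_one [simp]: "falg_value A f 1 = \<one>"
  using falg_value_single[of f 0 1] by (simp del: falg_value_single)

text \<open>Both sides are additive in each factor, which reduces the claim to two monomials; there
  the scalars are moved past the words.\<close>

lemma falg_value_mult: "falg_value A f (p * q) = falg_value A f p \<otimes> falg_value A f q"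
proof (induction p rule: falg_induct_UNIV)
  case (single w c)
  show ?case
  proof (induction q rule: falg_induct_UNIV)
    case (single w' c')
    then show ?case
      by (simp add: mult_single word_value_add smult_mult_left smult_mult_right mult.commute)
  qed (simp_all add: distrib_left falg_value_add r_distr)
qed (simp_all add: distrib_right falg_value_add l_distr)

lemma falg_value_uminus: "falg_value A f (- p) = \<ominus> falg_value A f p"
proof (rule minus_equality[symmetric])
  show "falg_value A f (- p) \<oplus> falg_value A f p = \<zero>"
    by (simp flip: falg_value_add)
qed simp_all

lemma falg_value_diff: "falg_value A f (p - q) = falg_value A f p \<ominus> falg_value A f q"
  using falg_value_add[of f p "- q"] by (simp add: falg_value_uminus a_minus_def)

text \<open>Evaluation only reaches what sums, products and scalars produce from the letters. The
  rule speaks about values in \<open>A\<close> rather than formal expressions, so it can drive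
  inductions over a presented algebra.\<close>

lemma falg_value_induct [consumes 1, case_names scalar add mult letter]:
  assumes "p \<in> carrier (free_algebra X)"
    and scalar: "\<And>c. P (c \<odot> \<one>)"
    and add: "\<And>x y. x \<in> carrier A \<Longrightarrow> y \<in> carrier A \<Longrightarrow> P x \<Longrightarrow> P y \<Longrightarrow> P (x \<oplus> y)"
    and mult: "\<And>x y. x \<in> carrier A \<Longrightarrow> y \<in> carrier A \<Longrightarrow> P x \<Longrightarrow> P y \<Longrightarrow> P (x \<otimes> y)"
    and letter: "\<And>g. g \<in> X \<Longrightarrow> P (letter_value A f g)"
  shows "P (falg_value A f p)"
  using assms(1)
proof (induction p rule: falg_induct)
  case zero
  then show ?case using scalar[of 0] by simp
next
  case (single w c)
  have "P (foldr (\<lambda>g x. letter_value A f g \<otimes> x) ws \<one>)" if "set ws \<subseteq> X" for ws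
    using that
  proof (induction ws)
    case Nil
    then show ?case using scalar[of 1] by simp
  next
    case (Cons g ws)
    then show ?case by (auto intro!: mult letter simp: foldr_word_closed)
  qed
  then have "P (word_value A f w)"
    using single by (simp add: word_value_def)
  \<comment> \<open>Closure under scaling is not among the assumptions; the coefficient enters as
    the factor \<open>c \<odot> \<one>\<close>.\<close>
  then have "P ((c \<odot> \<one>) \<otimes> word_value A f w)"
    by (intro mult scalar) auto
  then show ?case
    by (simp add: smult_mult_left)
next
  case (add p q)
  then show ?case by (simp add: falg_value_add assms(3))
qed

end

section \<open>Renaming generators into the alphabet of the localization\<close>

lemma embed_superset:
  assumes "finite K" "Poly_Mapping.keys p \<subseteq> K"
  shows "embed p = (\<Sum>w\<in>K. Poly_Mapping.single (Word (map Gen (letters w))) (Poly_Mapping.lookup p w))"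
  unfolding embed_def
  by (rule sum.mono_neutral_left) (use assms in \<open>auto simp: in_keys_iff\<close>)

lemma embed_add: "embed (p + q) = embed p + embed q"
proof -
  let ?K = "Poly_Mapping.keys p \<union> Poly_Mapping.keys q"
  have *: "finite ?K" "Poly_Mapping.keys (p + q) \<subseteq> ?K" "Poly_Mapping.keys p \<subseteq> ?K"
    "Poly_Mapping.keys q \<subseteq> ?K"
    by (auto simp: Poly_Mapping.keys_add)
  show ?thesis
    by (simp add: embed_superset[OF *(1,2)] embed_superset[OF *(1,3)]
        embed_superset[OF *(1,4)] Poly_Mapping.lookup_add single_add sum.distrib)
qed

lemma embed_single: "embed (Poly_Mapping.single w c) = Poly_Mapping.single (Word (map Gen (letters w))) c"
  by (cases "c = 0") (simp_all add: embed_def)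

lemma embed_zero: "embed 0 = 0"
  by (simp add: embed_def)

text \<open>This allows a map out of the localization to be compared with the map on the original
  algebra that it extends.\<close>

lemma (in complex_algebra) falg_value_embed:
  "falg_value A f (embed p) = falg_value A (f \<circ> Gen) p"
proof (induction p rule: falg_induct_UNIV)
  case (single w c)
  have "letter_value A (f \<circ> Gen) = (\<lambda>g. letter_value A f (Gen g))"
    by (auto simp: letter_value_def)
  then show ?case
    by (simp add: embed_single word_value_def foldr_map comp_def)
qed (simp_all add: embed_zero embed_add falg_value_add)


subsection \<open>Presented algebras\<close>

lemma free_algebra_simps [simp]:
  "mult (free_algebra X) = (*)" "one (free_algebra X) = 1" "zero (free_algebra X) = 0"
  "add (free_algebra X) = (+)"
  by (simp_all add: free_algebra_def)

lemma letters_add: "letters (v + w) = letters v @ letters w"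
  by (simp add: plus_fword_def)

lemma free_algebra_closed:
  shows zero_mem_free: "0 \<in> carrier (free_algebra X)"
    and one_mem_free: "1 \<in> carrier (free_algebra X)"
    and add_mem_free: "p \<in> carrier (free_algebra X) \<Longrightarrow> q \<in> carrier (free_algebra X) \<Longrightarrow>
      p + q \<in> carrier (free_algebra X)"
    and uminus_mem_free: "p \<in> carrier (free_algebra X) \<Longrightarrow> - p \<in> carrier (free_algebra X)"
    and diff_mem_free: "p \<in> carrier (free_algebra X) \<Longrightarrow> q \<in> carrier (free_algebra X) \<Longrightarrow>
      p - q \<in> carrier (free_algebra X)"
    and mult_mem_free: "p \<in> carrier (free_algebra X) \<Longrightarrow> q \<in> carrier (free_algebra X) \<Longrightarrow>
      p * q \<in> carrier (free_algebra X)"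
    and letter_mem_free: "g \<in> X \<Longrightarrow> letter g \<in> carrier (free_algebra X)"
    and const_mem_free: "const c \<in> carrier (free_algebra X)"
    and single_mem_free: "set (letters w) \<subseteq> X \<Longrightarrow> Poly_Mapping.single w c \<in> carrier (free_algebra X)"
proof -
  have neg: "- p \<in> carrier (free_algebra X)" if "p \<in> carrier (free_algebra X)" for p
    using that by (auto simp: free_algebra_def in_keys_iff)
  have add: "p + q \<in> carrier (free_algebra X)"
    if "p \<in> carrier (free_algebra X)" "q \<in> carrier (free_algebra X)" for p q
    using that Poly_Mapping.keys_add[of p q] unfolding free_algebra_def by auto
  show "0 \<in> carrier (free_algebra X)"
    by (auto simp: free_algebra_def)
  show "1 \<in> carrier (free_algebra X)"
    by (simp add: free_algebra_def zero_fword_def flip: single_one)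
  show "p \<in> carrier (free_algebra X) \<Longrightarrow> q \<in> carrier (free_algebra X) \<Longrightarrow>
      p + q \<in> carrier (free_algebra X)"
    by (rule add)
  show "p \<in> carrier (free_algebra X) \<Longrightarrow> - p \<in> carrier (free_algebra X)"
    by (rule neg)
  show "p \<in> carrier (free_algebra X) \<Longrightarrow> q \<in> carrier (free_algebra X) \<Longrightarrow>
      p - q \<in> carrier (free_algebra X)"
    using add[of p "- q"] neg[of q] by simp
  show "p \<in> carrier (free_algebra X) \<Longrightarrow> q \<in> carrier (free_algebra X) \<Longrightarrow>
      p * q \<in> carrier (free_algebra X)"
    using Poly_Mapping.keys_mult[of p q] 
    unfolding free_algebra_def by (fastforce simp: letters_add)
  show "g \<in> X \<Longrightarrow> letter g \<in> carrier (free_algebra X)"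
    by (auto simp: free_algebra_def letter_def)
  show "const c \<in> carrier (free_algebra X)"
    by (auto simp: free_algebra_def const_def zero_fword_def)
  show "set (letters w) \<subseteq> X \<Longrightarrow> Poly_Mapping.single w c \<in> carrier (free_algebra X)"
    by (auto simp: free_algebra_def)
qed

lemma ring_free_algebra: "ring (free_algebra X)"
proof (rule ringI)
  show "abelian_group (free_algebra X)"
    by (rule abelian_groupI)
      (auto simp: free_algebra_closed add.assoc add.commute intro: bexI[OF _ uminus_mem_free])
  show "Group.monoid (free_algebra X)"
    by (rule monoidI) (auto simp: free_algebra_closed mult.assoc)
qed (auto simp: algebra_simps)

lemma free_algebra_minus [simp]:
  assumes "p \<in> carrier (free_algebra X)" "q \<in> carrier (free_algebra X)"
  shows "p \<ominus>\<^bsub>free_algebra X\<^esub> q = p - q"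
proof -
  interpret ring "free_algebra X" by (rule ring_free_algebra)
  have "\<ominus>\<^bsub>free_algebra X\<^esub> q = - q"
    by (rule add.inv_equality) (use assms in \<open>auto simp: uminus_mem_free\<close>)
  then show ?thesis
    by (simp add: a_minus_def)
qed

text \<open>Scalars act on a presented algebra by left multiplication with the class of a constant;
  moving a scalar out of the right factor of a product requires constants to be central.\<close>

lemma const_commute: "const c * p = p * const c"
  by (induction p rule: falg_induct_UNIV)
    (simp_all add: const_def mult_single distrib_left distrib_right mult.commute)

lemma const_add: "const (c + d) = const c + const d"
  by (simp add: const_def single_add)

lemma const_mult: "const (c * d) = const c * const d"
  by (simp add: const_def mult_single)

lemma const_one: "const 1 = 1"
  by (simp add: const_def)

locale presentation =
  fixes X :: "'g set" and rel :: "('g falg \<times> 'g falg) set"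
  assumes rel_closed: "(p, q) \<in> rel \<Longrightarrow> p \<in> carrier (free_algebra X) \<and> q \<in> carrier (free_algebra X)"
begin

abbreviation "FA \<equiv> free_algebra X"
abbreviation "PA \<equiv> presented_algebra X rel"
abbreviation "cls \<equiv> alg_class X rel"

sublocale F: ring FA by (rule ring_free_algebra)

lemma relation_set_closed: "{p - q |p q. (p, q) \<in> rel} \<subseteq> carrier FA"
  using rel_closed by (auto intro!: diff_mem_free)

sublocale I: ideal "relation_ideal X rel" FA
  unfolding relation_ideal_def by (rule F.genideal_ideal[OF relation_set_closed])

lemma presented_sel:
  "carrier PA = carrier (FA Quot relation_ideal X rel)"
  "mult PA = mult (FA Quot relation_ideal X rel)"
  "one PA = one (FA Quot relation_ideal X rel)"
  "zero PA = zero (FA Quot relation_ideal X rel)"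
  "add PA = add (FA Quot relation_ideal X rel)"
  by (simp_all add: presented_algebra_def Let_def)

lemma smult_presented: "c \<odot>\<^bsub>PA\<^esub> x = cls (const c) \<otimes>\<^bsub>PA\<^esub> x"
  by (simp add: presented_algebra_def Let_def)

lemma carrier_presented: "carrier PA = cls ` carrier FA"
  unfolding presented_sel FactRing_simps alg_class_def by auto

lemma cls_closed: "p \<in> carrier FA \<Longrightarrow> cls p \<in> carrier PA"
  by (simp add: carrier_presented)

lemma cls_hom:
  "p \<in> carrier FA \<Longrightarrow> q \<in> carrier FA \<Longrightarrow> cls (p + q) = cls p \<oplus>\<^bsub>PA\<^esub> cls q"
  "p \<in> carrier FA \<Longrightarrow> q \<in> carrier FA \<Longrightarrow> cls (p * q) = cls p \<otimes>\<^bsub>PA\<^esub> cls q"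
  "cls 1 = \<one>\<^bsub>PA\<^esub>"
  using I.rcos_ring_hom ring_hom_add[OF I.rcos_ring_hom] ring_hom_mult[OF I.rcos_ring_hom]
    ring_hom_one[OF I.rcos_ring_hom]
  unfolding presented_sel alg_class_def by simp_all

text \<open>\<open>PA\<close> extends the quotient ring by a scalar multiplication, hence is a
  record of another type; the ring axioms are transferred field by field through
  \<open>presented_sel\<close>.\<close>

lemma ring_presented: "ring PA"
proof -
  interpret Q: ring "FA Quot relation_ideal X rel"
    by (rule I.quotient_is_ring)
  show ?thesis
  proof (rule ringI)
    show "abelian_group PA"
      by (rule abelian_groupI)
        (simp_all add: presented_sel Q.a_ac Q.add.l_inv_ex)
    show "Group.monoid PA"
      by (rule monoidI) (auto simp: presented_sel Q.m_assoc)
  qed (simp_all add: presented_sel Q.l_distr Q.r_distr)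
qed

sublocale P: ring PA by (rule ring_presented)

sublocale P: complex_algebra PA
proof
  fix x y c d
  assume "x \<in> carrier PA" "y \<in> carrier PA"
  then obtain p q where xy: "x = cls p" "p \<in> carrier FA" "y = cls q" "q \<in> carrier FA"
    by (auto simp: carrier_presented)
  note [simp] = smult_presented cls_closed free_algebra_closed cls_hom[symmetric]
  show "c \<odot>\<^bsub>PA\<^esub> (x \<oplus>\<^bsub>PA\<^esub> y) = c \<odot>\<^bsub>PA\<^esub> x \<oplus>\<^bsub>PA\<^esub> c \<odot>\<^bsub>PA\<^esub> y"
    using xy by (simp add: distrib_left)
  show "c \<odot>\<^bsub>PA\<^esub> x \<otimes>\<^bsub>PA\<^esub> y = c \<odot>\<^bsub>PA\<^esub> (x \<otimes>\<^bsub>PA\<^esub> y)"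
    using xy by (simp add: mult.assoc)
  show "x \<otimes>\<^bsub>PA\<^esub> (c \<odot>\<^bsub>PA\<^esub> y) = c \<odot>\<^bsub>PA\<^esub> (x \<otimes>\<^bsub>PA\<^esub> y)"
    using xy by (simp add: const_commute[of c p] flip: mult.assoc)
next
  fix x c d
  assume "x \<in> carrier PA"
  then obtain p where xy: "x = cls p" "p \<in> carrier FA"
    by (auto simp: carrier_presented)
  note [simp] = smult_presented cls_closed free_algebra_closed cls_hom[symmetric]
  show "c \<odot>\<^bsub>PA\<^esub> x \<in> carrier PA" "1 \<odot>\<^bsub>PA\<^esub> x = x"
    "(c + d) \<odot>\<^bsub>PA\<^esub> x = c \<odot>\<^bsub>PA\<^esub> x \<oplus>\<^bsub>PA\<^esub> d \<odot>\<^bsub>PA\<^esub> x"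
    "c \<odot>\<^bsub>PA\<^esub> (d \<odot>\<^bsub>PA\<^esub> x) = (c * d) \<odot>\<^bsub>PA\<^esub> x"
    using xy by (simp_all add: const_one distrib_right const_mult mult.assoc const_add
        del: cls_hom(3))
qed

lemma cls_const: "cls (const c) = c \<odot>\<^bsub>PA\<^esub> \<one>\<^bsub>PA\<^esub>"
  by (simp add: smult_presented cls_closed const_mem_free)

text \<open>Every element of \<open>PA\<close> thereby becomes a value of evaluation, so
  \<open>falg_value_induct\<close> applies to it. Both sides agree on words by multiplicativity, and
  then on sums of monomials.\<close>

lemma cls_eq_value:
  assumes "p \<in> carrier FA"
  shows "cls p = falg_value PA (\<lambda>g. cls (letter g)) p"
proof -
  have word: "cls (Poly_Mapping.single (Word ws) 1) = word_value PA (\<lambda>g. cls (letter g)) (Word ws)"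
    if "set ws \<subseteq> X" for ws
    using that
  proof (induction ws)
    case Nil
    then show ?case
      using cls_hom(3) by (simp add: P.word_value_zero[unfolded zero_fword_def] flip: zero_fword_def)
  next
    case (Cons g ws)
    have "Poly_Mapping.single (Word (g # ws)) 1 = letter g * Poly_Mapping.single (Word ws) (1::complex)"
      by (simp add: letter_def mult_single plus_fword_def)
    with Cons show ?case
      by (simp add: cls_hom free_algebra_closed word_value_def cls_closed)
  qed
  \<comment> \<open>Membership in the free algebra is carried through the induction, because
    \<open>cls_hom\<close> requires it of both summands.\<close>
  from assms have "cls p = falg_value PA (\<lambda>g. cls (letter g)) p \<and> p \<in> carrier FA"
  proof (induction p rule: falg_induct)
    case zero
    \<comment> \<open>\<open>cls_hom\<close> does not cover zero; an element that equals its own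
      double is zero.\<close>
    have "cls 0 \<oplus>\<^bsub>PA\<^esub> cls 0 = cls 0"
      by (simp add: zero_mem_free flip: cls_hom)
    then have "cls 0 = \<zero>\<^bsub>PA\<^esub>"
      using cls_closed[OF zero_mem_free] by simp
    then show ?case
      by (simp add: zero_mem_free)
  next
    case (single w c)
    have "Poly_Mapping.single w c = const c * Poly_Mapping.single w 1"
      by (simp add: const_def mult_single)
    then have "cls (Poly_Mapping.single w c) = c \<odot>\<^bsub>PA\<^esub> word_value PA (\<lambda>g. cls (letter g)) w"
      using single word[of "letters w"]
      by (simp only: cls_hom free_algebra_closed cls_const fword.collapse)
        (simp add: P.smult_mult_left)
    then show ?case
      using single by (simp add: single_mem_free)
  next
    case (add p q)
    then show ?case
      by (simp add: cls_hom P.falg_value_add add_mem_free)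
  qed
  then show ?thesis by simp
qed

lemma cls_rel:
  assumes "(p, q) \<in> rel"
  shows "cls p = cls q"
proof -
  from assms have "p - q \<in> relation_ideal X rel"
    unfolding relation_ideal_def by (intro subsetD[OF F.genideal_self[OF relation_set_closed]]) auto
  then show ?thesis
    using rel_closed[OF assms] F.quotient_eq_iff_same_a_r_cos[OF I.ideal_axioms, of p q]
    by (simp add: alg_class_def)
qed

lemma cls_eq_iff:
  assumes "p \<in> carrier FA" "q \<in> carrier FA"
  shows "cls p = cls q \<longleftrightarrow> p - q \<in> relation_ideal X rel"
  using assms F.quotient_eq_iff_same_a_r_cos[OF I.ideal_axioms, of p q] by (simp add: alg_class_def)

text \<open>The kernel of evaluation is an ideal containing all differences \<open>p - q\<close>
  coming from \<open>rel\<close>, hence it contains the ideal they generate.\<close>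

lemma value_factors:
  assumes "complex_algebra B"
    and rel: "\<And>p q. (p, q) \<in> rel \<Longrightarrow> falg_value B f p = falg_value B f q"
    and "p \<in> carrier FA" "q \<in> carrier FA" "cls p = cls q"
  shows "falg_value B f p = falg_value B f q"
proof -
  interpret B: complex_algebra B by fact
  interpret V: ring_hom_ring FA B "falg_value B f"
    by (intro ring_hom_ringI2 ring_free_algebra ring_hom_memI B.ring_axioms)
      (simp_all add: B.falg_value_add B.falg_value_mult)
  have "p - q \<in> a_kernel FA B (falg_value B f)" if "(p, q) \<in> rel" for p q
  proof -
    have "falg_value B f (p - q) = falg_value B f q \<ominus>\<^bsub>B\<^esub> falg_value B f q"
      by (simp only: B.falg_value_diff rel[OF that])
    then show ?thesis
      unfolding a_kernel_def' using rel_closed[OF that] by (auto intro: diff_mem_free)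
  qed
  then have "{p - q |p q. (p, q) \<in> rel} \<subseteq> a_kernel FA B (falg_value B f)"
    by blast
  then have "relation_ideal X rel \<subseteq> a_kernel FA B (falg_value B f)"
    unfolding relation_ideal_def by (rule F.genideal_minimal[OF V.kernel_is_ideal])
  moreover have "p - q \<in> relation_ideal X rel"
    using assms(5) cls_eq_iff[OF assms(3,4)] by blast
  ultimately have "falg_value B f (p - q) = \<zero>\<^bsub>B\<^esub>"
    unfolding a_kernel_def' by blast
  then show ?thesis
    unfolding B.falg_value_diff by simp
qed

theorem universal_property:
  assumes "complex_algebra B"
    and "\<And>p q. (p, q) \<in> rel \<Longrightarrow> falg_value B f p = falg_value B f q"
  obtains F where "F \<in> algebra_hom PA B" "\<And>p. p \<in> carrier FA \<Longrightarrow> F (cls p) = falg_value B f p"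
proof -
  interpret B: complex_algebra B by fact
  \<comment> \<open>Any representative may be chosen: \<open>value_factors\<close> makes the value
    independent of it.\<close>
  define F where "F x = falg_value B f (SOME p. p \<in> carrier FA \<and> cls p = x)" for x
  have F: "F (cls p) = falg_value B f p" if "p \<in> carrier FA" for p
  proof -
    have "\<exists>q. q \<in> carrier FA \<and> cls q = cls p" using that by blast
    from someI_ex[OF this] show ?thesis
      unfolding F_def by (intro value_factors[OF assms]) (use that in auto)
  qed
  have "F \<in> algebra_hom PA B"
    unfolding algebra_hom_def
  proof (intro CollectI conjI ring_hom_memI ballI allI)
    fix x y c assume "x \<in> carrier PA" "y \<in> carrier PA"
    then obtain p q where xy: "x = cls p" "p \<in> carrier FA" "y = cls q" "q \<in> carrier FA"
      by (auto simp: carrier_presented)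
    then show "F (x \<otimes>\<^bsub>PA\<^esub> y) = F x \<otimes>\<^bsub>B\<^esub> F y" "F (x \<oplus>\<^bsub>PA\<^esub> y) = F x \<oplus>\<^bsub>B\<^esub> F y"
      by (simp_all add: F B.falg_value_add B.falg_value_mult free_algebra_closed flip: cls_hom)
  next
    fix x c assume "x \<in> carrier PA"
    then obtain p where "x = cls p" "p \<in> carrier FA"
      by (auto simp: carrier_presented)
    then show "F x \<in> carrier B" "F (c \<odot>\<^bsub>PA\<^esub> x) = c \<odot>\<^bsub>B\<^esub> F x"
      by (simp_all add: F smult_presented B.falg_value_mult free_algebra_closed
          B.smult_mult_left flip: cls_hom)
  next
    show "F \<one>\<^bsub>PA\<^esub> = \<one>\<^bsub>B\<^esub>"
      using F[OF one_mem_free] by (simp add: cls_hom(3))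
  qed
  with F that show thesis by blast
qed

end

lemma algebra_homD:
  assumes "f \<in> algebra_hom A B"
  shows "x \<in> carrier A \<Longrightarrow> f x \<in> carrier B"
    "x \<in> carrier A \<Longrightarrow> y \<in> carrier A \<Longrightarrow> f (x \<otimes>\<^bsub>A\<^esub> y) = f x \<otimes>\<^bsub>B\<^esub> f y"
    "x \<in> carrier A \<Longrightarrow> y \<in> carrier A \<Longrightarrow> f (x \<oplus>\<^bsub>A\<^esub> y) = f x \<oplus>\<^bsub>B\<^esub> f y"
    "f \<one>\<^bsub>A\<^esub> = \<one>\<^bsub>B\<^esub>"
    "x \<in> carrier A \<Longrightarrow> f (c \<odot>\<^bsub>A\<^esub> x) = c \<odot>\<^bsub>B\<^esub> f x"
  using assms unfolding algebra_hom_def by (auto simp: ring_hom_def)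


subsection \<open>Universal localization\<close>

lemma embed_closed:
  "p \<in> carrier (free_algebra X) \<Longrightarrow> embed p \<in> carrier (free_algebra (loc_letters X \<Sigma>))"
proof (induction p rule: falg_induct)
  case (single w c)
  then show ?case
    unfolding embed_single by (intro single_mem_free) (auto simp: loc_letters_def)
qed (simp_all add: embed_zero embed_add zero_mem_free add_mem_free)

locale localization = presentation X rel
  for X :: "'g set" and rel :: "('g falg \<times> 'g falg) set" +
  fixes \<Sigma> :: "'g falg set set"
  assumes \<Sigma>_closed: "\<Sigma> \<subseteq> carrier (presented_algebra X rel)"
begin

text \<open>An element of \<open>\<Sigma>\<close> is a coset, and \<open>loc_relations\<close>
  ranges over all of its members, so each member must be known to represent that very coset.\<close>

lemma representative:
  assumes "s \<in> \<Sigma>" "p \<in> s"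
  shows "p \<in> carrier FA" "cls p = s"
proof -
  obtain p0 where s: "p0 \<in> carrier FA" "s = relation_ideal X rel +>\<^bsub>FA\<^esub> p0"
    using assms(1) \<Sigma>_closed by (auto simp: carrier_presented alg_class_def)
  show "p \<in> carrier FA"
    using assms(2) s I.a_subset F.a_r_coset_subset_G by blast
  show "cls p = s"
    using assms(2) I.a_repr_independence' s by (simp add: alg_class_def)
qed

lemma representative_exists:
  assumes "s \<in> \<Sigma>"
  obtains p where "p \<in> s" "p \<in> carrier FA" "cls p = s"
proof -
  obtain p where "p \<in> carrier FA" "s = cls p"
    using assms \<Sigma>_closed by (auto simp: carrier_presented)
  moreover from this have "p \<in> s"
    using I.a_rcos_self by (simp add: alg_class_def)
  ultimately show thesis
    using that by blast
qed

sublocale L: presentation "loc_letters X \<Sigma>" "loc_relations rel \<Sigma>"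
proof
  fix p q assume "(p, q) \<in> loc_relations rel \<Sigma>"
  moreover have "embed p \<in> carrier (free_algebra (loc_letters X \<Sigma>))" if "s \<in> \<Sigma>" "p \<in> s" for p s
    using representative[OF that] by (intro embed_closed)
  moreover have "letter (Inv s) \<in> carrier (free_algebra (loc_letters X \<Sigma>))" if "s \<in> \<Sigma>" for s
    using that by (intro letter_mem_free) (auto simp: loc_letters_def)
  ultimately show "p \<in> carrier (free_algebra (loc_letters X \<Sigma>)) \<and>
      q \<in> carrier (free_algebra (loc_letters X \<Sigma>))"
    unfolding loc_relations_def
    by (elim UnE CollectE exE conjE) (auto simp: embed_closed rel_closed intro!: mult_mem_free one_mem_free)
qed

definition gen :: "'g \<Rightarrow> 'g loc_letter falg set" where
  "gen g = L.cls (letter (Gen g))"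

lemma gen_closed: "g \<in> X \<Longrightarrow> gen g \<in> carrier L.PA"
  unfolding gen_def by (intro L.cls_closed letter_mem_free) (auto simp: loc_letters_def)

lemma letter_Inv_mem: "s \<in> \<Sigma> \<Longrightarrow> letter (Inv s) \<in> carrier L.FA"
  by (intro letter_mem_free) (auto simp: loc_letters_def)

lemma cls_embed: "p \<in> carrier FA \<Longrightarrow> L.cls (embed p) = falg_value L.PA gen p"
  by (simp add: L.cls_eq_value embed_closed L.P.falg_value_embed comp_def gen_def[abs_def])

lemma value_gen_rel:
  assumes "(p, q) \<in> rel"
  shows "falg_value L.PA gen p = falg_value L.PA gen q"
proof -
  have "(embed p, embed q) \<in> loc_relations rel \<Sigma>"
    using assms by (auto simp: loc_relations_def)
  from L.cls_rel[OF this] show ?thesis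
    using rel_closed[OF assms] by (simp add: cls_embed)
qed

lemma cls_Inv:
  assumes "s \<in> \<Sigma>" "p \<in> s"
  shows "falg_value L.PA gen p \<otimes>\<^bsub>L.PA\<^esub> L.cls (letter (Inv s)) = \<one>\<^bsub>L.PA\<^esub>"
    and "L.cls (letter (Inv s)) \<otimes>\<^bsub>L.PA\<^esub> falg_value L.PA gen p = \<one>\<^bsub>L.PA\<^esub>"
proof -
  have "(embed p * letter (Inv s), 1) \<in> loc_relations rel \<Sigma>"
    "(letter (Inv s) * embed p, 1) \<in> loc_relations rel \<Sigma>"
    using assms by (auto simp: loc_relations_def)
  then have "L.cls (embed p * letter (Inv s)) = L.cls 1" "L.cls (letter (Inv s) * embed p) = L.cls 1"
    by (auto dest: L.cls_rel)
  then show "falg_value L.PA gen p \<otimes>\<^bsub>L.PA\<^esub> L.cls (letter (Inv s)) = \<one>\<^bsub>L.PA\<^esub>"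
    "L.cls (letter (Inv s)) \<otimes>\<^bsub>L.PA\<^esub> falg_value L.PA gen p = \<one>\<^bsub>L.PA\<^esub>"
    using assms representative[OF assms] letter_Inv_mem
    by (simp_all add: L.cls_hom embed_closed cls_embed)
qed

lemma localization_map_exists:
  obtains F where "F \<in> algebra_hom PA L.PA"
    "\<And>p. p \<in> carrier FA \<Longrightarrow> F (cls p) = falg_value L.PA gen p"
    "\<And>s. s \<in> \<Sigma> \<Longrightarrow> F s \<in> Units L.PA"
proof -
  obtain F where F: "F \<in> algebra_hom PA L.PA"
    "\<And>p. p \<in> carrier FA \<Longrightarrow> F (cls p) = falg_value L.PA gen p"
    using universal_property[OF L.P.complex_algebra_axioms value_gen_rel] by blast
  moreover have "F s \<in> Units L.PA" if s: "s \<in> \<Sigma>" for s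
  proof -
    obtain p where p: "p \<in> s" "p \<in> carrier FA" "cls p = s"
      using representative_exists[OF s] .
    show ?thesis
      using cls_Inv[OF s p(1)] F(2)[OF p(2)] p(3) L.cls_closed[OF letter_Inv_mem[OF s]]
      by (auto simp: Units_def)
  qed
  ultimately show thesis
    using that by blast
qed

theorem localization_universal_property:
  assumes "complex_algebra B"
    and closed: "\<And>g. g \<in> X \<Longrightarrow> f g \<in> carrier B"
    and F: "\<And>p. p \<in> carrier FA \<Longrightarrow> F (cls p) = falg_value B f p"
    and units: "\<And>s. s \<in> \<Sigma> \<Longrightarrow> F s \<in> Units B"
  obtains G where "G \<in> algebra_hom L.PA B" "\<And>g. g \<in> X \<Longrightarrow> G (gen g) = f g"
proof -
  interpret B: complex_algebra B by fact
  \<comment> \<open>The new letters leave no freedom: \<open>Inv s\<close> has to go to the inverse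
    of the image of \<open>s\<close>.\<close>
  define f' where "f' = case_loc_letter f (\<lambda>s. inv\<^bsub>B\<^esub> (F s))"
  have embed: "falg_value B f' (embed p) = F (cls p)" if "p \<in> carrier FA" for p
    by (simp add: B.falg_value_embed f'_def comp_def F[OF that])
  have Inv: "falg_value B f' (letter (Inv s)) = inv\<^bsub>B\<^esub> (F s)" if "s \<in> \<Sigma>" for s
    using B.Units_inv_closed[OF units[OF that]] by (simp add: f'_def)
  have "falg_value B f' p = falg_value B f' q" if "(p, q) \<in> loc_relations rel \<Sigma>" for p q
  proof -
    from that consider (rel) p' q' where "(p', q') \<in> rel" "p = embed p'" "q = embed q'"
      | (right) p' s where "s \<in> \<Sigma>" "p' \<in> s" "p = embed p' * letter (Inv s)" "q = 1"
      | (left) p' s where "s \<in> \<Sigma>" "p' \<in> s" "p = letter (Inv s) * embed p'" "q = 1"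
      unfolding loc_relations_def by blast
    then show ?thesis
    proof cases
      case rel
      then show ?thesis
        using rel_closed[OF rel(1)] cls_rel[OF rel(1)] by (simp add: embed)
    next
      case right
      then show ?thesis
        using representative[OF right(1,2)] units[OF right(1)]
        by (simp add: B.falg_value_mult embed Inv del: B.falg_value_letter)
    next
      case left
      then show ?thesis
        using representative[OF left(1,2)] units[OF left(1)]
        by (simp add: B.falg_value_mult embed Inv del: B.falg_value_letter)
    qed
  qed
  then obtain G where G: "G \<in> algebra_hom L.PA B"
    "\<And>p. p \<in> carrier L.FA \<Longrightarrow> G (L.cls p) = falg_value B f' p"
    using L.universal_property[OF assms(1)] by blast
  have "G (gen g) = f g" if "g \<in> X" for g
    using that closed[OF that] G(2)[of "letter (Gen g)"]
    by (simp add: gen_def f'_def letter_mem_free loc_letters_def)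
  with G(1) that show thesis
    by blast
qed

text \<open>Each adjoined letter is a two-sided inverse of an image of the original algebra, so a
  property stable under inversion need not mention those letters. This is what later determines maps
  by their values on the original generators.\<close>

lemma localization_induct [consumes 1, case_names scalar add mult inverse gen]:
  assumes "x \<in> carrier L.PA"
    and scalar: "\<And>c. P (c \<odot>\<^bsub>L.PA\<^esub> \<one>\<^bsub>L.PA\<^esub>)"
    and add: "\<And>x y. x \<in> carrier L.PA \<Longrightarrow> y \<in> carrier L.PA \<Longrightarrow> P x \<Longrightarrow> P y \<Longrightarrow> P (x \<oplus>\<^bsub>L.PA\<^esub> y)"
    and mult: "\<And>x y. x \<in> carrier L.PA \<Longrightarrow> y \<in> carrier L.PA \<Longrightarrow> P x \<Longrightarrow> P y \<Longrightarrow> P (x \<otimes>\<^bsub>L.PA\<^esub> y)"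
    and inverse: "\<And>x y. x \<in> carrier L.PA \<Longrightarrow> y \<in> carrier L.PA \<Longrightarrow> x \<otimes>\<^bsub>L.PA\<^esub> y = \<one>\<^bsub>L.PA\<^esub> \<Longrightarrow>
      y \<otimes>\<^bsub>L.PA\<^esub> x = \<one>\<^bsub>L.PA\<^esub> \<Longrightarrow> P x \<Longrightarrow> P y"
    and gen: "\<And>g. g \<in> X \<Longrightarrow> P (gen g)"
  shows "P x"
proof -
  \<comment> \<open>The denominators are settled first: the inversion step for \<open>Inv s\<close>
    relies on \<open>P\<close> for a representative of \<open>s\<close>.\<close>
  have P_gen: "P (falg_value L.PA gen p)" if "p \<in> carrier FA" for p
    using that
    by (rule L.P.falg_value_induct)
      (use scalar add mult gen gen_closed in \<open>auto simp: L.P.letter_value_eq\<close>)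
  obtain p where p: "p \<in> carrier L.FA" "x = L.cls p"
    using assms(1) L.carrier_presented by auto
  have "P (falg_value L.PA (\<lambda>g. L.cls (letter g)) p)"
    using p(1)
  proof (induction rule: L.P.falg_value_induct)
    case (letter g)
    then consider g' where "g = Gen g'" "g' \<in> X" | s where "g = Inv s" "s \<in> \<Sigma>"
      by (auto simp: loc_letters_def)
    then show ?case
    proof cases
      case 1
      then show ?thesis
        using gen[of g'] gen_closed[of g'] by (simp add: gen_def)
    next
      case 2
      then obtain q where q: "q \<in> s" "q \<in> carrier FA"
        using representative_exists by blast
      have "P (L.cls (letter (Inv s)))"
        by (rule inverse[OF L.P.falg_value_closed L.cls_closed[OF letter_Inv_mem[OF 2(2)]]
              cls_Inv[OF 2(2) q(1)] P_gen[OF q(2)]])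
      then show ?thesis
        using 2 L.cls_closed[OF letter_Inv_mem[OF 2(2)]] by simp
    qed
  qed (use scalar add mult in auto)
  then show ?thesis
    using p by (simp add: L.cls_eq_value)
qed

end


section \<open>The algebra \<open>C\<close> and the homomorphism \<open>\<phi>\<close>\<close>

text \<open>A homomorphism from \<open>Cat hbar\<close> to \<open>B\<close> amounts to such a
  family. The relations are written with the operations of \<open>B\<close>, and subtraction as
  scaling by \<open>- h\<close>, so that simplification can check them in a concrete
  algebra.\<close>

definition cat_solution :: "real \<Rightarrow> (complex, 'b) module \<Rightarrow> (cat_gen \<Rightarrow> 'b) \<Rightarrow> bool" where
  "cat_solution hbar B f \<longleftrightarrow> range f \<subseteq> carrier B \<and>
     (let U = f gU; R = f gR; Ri = f gRi; W = f gW; Wi = f gWi;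
          q = complex_of_real (exp hbar); qi = complex_of_real (exp (- hbar)); h = complex_of_real hbar
      in W \<otimes>\<^bsub>B\<^esub> Wi = \<one>\<^bsub>B\<^esub> \<and> Wi \<otimes>\<^bsub>B\<^esub> W = \<one>\<^bsub>B\<^esub> \<and> R \<otimes>\<^bsub>B\<^esub> Ri = \<one>\<^bsub>B\<^esub> \<and> Ri \<otimes>\<^bsub>B\<^esub> R = \<one>\<^bsub>B\<^esub> \<and>
         R \<otimes>\<^bsub>B\<^esub> U = U \<otimes>\<^bsub>B\<^esub> R \<and> Ri \<otimes>\<^bsub>B\<^esub> U = U \<otimes>\<^bsub>B\<^esub> Ri \<and>
         W \<otimes>\<^bsub>B\<^esub> R = q \<odot>\<^bsub>B\<^esub> (R \<otimes>\<^bsub>B\<^esub> W) \<and> W \<otimes>\<^bsub>B\<^esub> Ri = qi \<odot>\<^bsub>B\<^esub> (Ri \<otimes>\<^bsub>B\<^esub> W) \<and>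
         Wi \<otimes>\<^bsub>B\<^esub> R = qi \<odot>\<^bsub>B\<^esub> (R \<otimes>\<^bsub>B\<^esub> Wi) \<and> Wi \<otimes>\<^bsub>B\<^esub> Ri = q \<odot>\<^bsub>B\<^esub> (Ri \<otimes>\<^bsub>B\<^esub> Wi) \<and>
         W \<otimes>\<^bsub>B\<^esub> U = (U \<otimes>\<^bsub>B\<^esub> W) \<oplus>\<^bsub>B\<^esub> (h \<odot>\<^bsub>B\<^esub> W) \<and>
         Wi \<otimes>\<^bsub>B\<^esub> U = (U \<otimes>\<^bsub>B\<^esub> Wi) \<oplus>\<^bsub>B\<^esub> ((- h) \<odot>\<^bsub>B\<^esub> Wi))"

lemma cat_solution_iff:
  assumes "complex_algebra B" "range f \<subseteq> carrier B"
  shows "cat_solution hbar B f \<longleftrightarrow>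
    (\<forall>(p, q) \<in> cat_relations hbar. falg_value B f p = falg_value B f q)"
proof -
  interpret B: complex_algebra B by fact
  have f: "f g \<in> carrier B" for g
    using assms(2) by auto
  show ?thesis
    using assms(2) unfolding cat_solution_def cat_relations_def Let_def
    by (simp add: B.falg_value_mult B.falg_value_add B.falg_value_diff f
        B.smult_mult_left B.smult_uminus a_minus_def conj_ac)
qed

lemma presentation_cat: "presentation UNIV (cat_relations hbar)"
  by standard (simp add: free_algebra_def)

lemma complex_algebra_Cat: "complex_algebra (Cat hbar)"
proof -
  interpret presentation UNIV "cat_relations hbar" by (rule presentation_cat)
  show ?thesis
    unfolding Cat_def by (rule P.complex_algebra_axioms)
qed

interpretation Cat: complex_algebra "Cat hbar" for hbar
  by (rule complex_algebra_Cat)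

lemma cat_closed [simp]: "cat hbar g \<in> carrier (Cat hbar)"
proof -
  interpret presentation UNIV "cat_relations hbar" by (rule presentation_cat)
  show ?thesis
    unfolding Cat_def cat_def by (simp add: cls_closed letter_mem_free)
qed

text \<open>The third conclusion records the value on every class, since
  \<open>localization_universal_property\<close> asks for a map that agrees with evaluation.\<close>

lemma Cat_universal_property:
  assumes "complex_algebra B" "cat_solution hbar B f"
  obtains F where "F \<in> algebra_hom (Cat hbar) B" "\<And>g. F (cat hbar g) = f g"
    "\<And>p. F (alg_class UNIV (cat_relations hbar) p) = falg_value B f p"
proof -
  interpret presentation UNIV "cat_relations hbar" by (rule presentation_cat)
  interpret B: complex_algebra B by fact
  have f: "range f \<subseteq> carrier B"
    using assms(2) by (simp add: cat_solution_def)
  have "falg_value B f p = falg_value B f q" if "(p, q) \<in> cat_relations hbar" for p q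
    using cat_solution_iff[OF assms(1) f] assms(2) that by blast
  then obtain F where F: "F \<in> algebra_hom (Cat hbar) B"
    "\<And>p. p \<in> carrier (free_algebra UNIV) \<Longrightarrow>
      F (alg_class UNIV (cat_relations hbar) p) = falg_value B f p"
    using universal_property[OF assms(1), folded Cat_def] by blast
  then have F': "F (alg_class UNIV (cat_relations hbar) p) = falg_value B f p" for p
    by (simp add: free_algebra_def)
  show thesis
    using f by (intro that[OF F(1) _ F']) (simp add: cat_def F' B.letter_value_eq image_subset_iff)
qed

abbreviation cat_scalars :: "real \<Rightarrow> cat_gen falg set set" where
  "cat_scalars hbar \<equiv> range (\<lambda>c. c \<odot>\<^bsub>Cat hbar\<^esub> \<one>\<^bsub>Cat hbar\<^esub>)"

lemma ZUR_induct [consumes 1, case_names scalar gen add mult]: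
  assumes "x \<in> ZUR hbar"
    and scalar: "\<And>c. P (c \<odot>\<^bsub>Cat hbar\<^esub> \<one>\<^bsub>Cat hbar\<^esub>)"
    and gen: "\<And>g. g \<in> {gU, gR, gRi} \<Longrightarrow> P (cat hbar g)"
    and add: "\<And>x y. x \<in> ZUR hbar \<Longrightarrow> y \<in> ZUR hbar \<Longrightarrow> P x \<Longrightarrow> P y \<Longrightarrow> P (x \<oplus>\<^bsub>Cat hbar\<^esub> y)"
    and mult: "\<And>x y. x \<in> ZUR hbar \<Longrightarrow> y \<in> ZUR hbar \<Longrightarrow> P x \<Longrightarrow> P y \<Longrightarrow> P (x \<otimes>\<^bsub>Cat hbar\<^esub> y)"
  shows "P x"
proof -
  let ?H = "{cat hbar gU, cat hbar gR, cat hbar gRi} \<union> cat_scalars hbar"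
  have H: "?H \<subseteq> carrier (Cat hbar)"
    by auto
  have Z: "ZUR hbar = generate_ring (Cat hbar) ?H"
    by (simp add: ZUR_def generated_subalgebra_def)
  show ?thesis
    using assms(1) unfolding Z
  proof (induction rule: generate_ring.induct)
    case one
    then show ?case using scalar[of 1] by simp
  next
    case (incl h)
    then show ?case using scalar gen by auto
  next
    case (a_inv h)
    have h: "h \<in> carrier (Cat hbar)"
      using a_inv Cat.generate_ring_in_carrier[OF H] by blast
    \<comment> \<open>Additive inverses are a clause of \<open>generate_ring\<close>; here they
      become products with the scalar -1, itself one of the generators, so the induction rule can
      omit that case.\<close>
    have "(-1) \<odot>\<^bsub>Cat hbar\<^esub> \<one>\<^bsub>Cat hbar\<^esub> \<in> ZUR hbar"
      unfolding Z by (intro generate_ring.incl) auto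
    then have "P (((-1) \<odot>\<^bsub>Cat hbar\<^esub> \<one>\<^bsub>Cat hbar\<^esub>) \<otimes>\<^bsub>Cat hbar\<^esub> h)"
      using a_inv by (intro mult scalar) (auto simp: Z)
    then show ?case
      using h by (simp add: Cat.smult_mult_left Cat.uminus_eq_smult)
  qed (auto intro!: add mult simp: Z)
qed

lemma ZUR_closed:
  shows ZUR_carrier: "x \<in> ZUR hbar \<Longrightarrow> x \<in> carrier (Cat hbar)"
    and ZUR_scalar: "c \<odot>\<^bsub>Cat hbar\<^esub> \<one>\<^bsub>Cat hbar\<^esub> \<in> ZUR hbar"
    and ZUR_one: "\<one>\<^bsub>Cat hbar\<^esub> \<in> ZUR hbar"
    and ZUR_gen: "g \<in> {gU, gR, gRi} \<Longrightarrow> cat hbar g \<in> ZUR hbar"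
    and ZUR_add: "x \<in> ZUR hbar \<Longrightarrow> y \<in> ZUR hbar \<Longrightarrow> x \<oplus>\<^bsub>Cat hbar\<^esub> y \<in> ZUR hbar"
    and ZUR_mult: "x \<in> ZUR hbar \<Longrightarrow> y \<in> ZUR hbar \<Longrightarrow> x \<otimes>\<^bsub>Cat hbar\<^esub> y \<in> ZUR hbar"
proof -
  have "{cat hbar gU, cat hbar gR, cat hbar gRi} \<union> cat_scalars hbar \<subseteq> carrier (Cat hbar)"
    by auto
  from Cat.generate_ring_in_carrier[OF this]
  show "x \<in> ZUR hbar \<Longrightarrow> x \<in> carrier (Cat hbar)"
    by (simp add: ZUR_def generated_subalgebra_def)
qed (auto simp: ZUR_def generated_subalgebra_def intro: generate_ring.intros)

lemma ZUR_smult: "x \<in> ZUR hbar \<Longrightarrow> c \<odot>\<^bsub>Cat hbar\<^esub> x \<in> ZUR hbar"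
  using ZUR_mult[OF ZUR_scalar[of hbar c], of x] ZUR_carrier[of x]
  by (simp add: Cat.smult_mult_left)

subsection \<open>Representation by multiplication and shift operators\<close>

type_synonym operator = "(real \<Rightarrow> complex) \<Rightarrow> real \<Rightarrow> complex"

text \<open>The operators act on arbitrary functions, so that products and shifts come without
  regularity conditions; smoothness is recovered afterwards for the functions that
  \<open>ZUR\<close> produces.\<close>

definition linear_operators :: "(complex, operator) module" where
  "linear_operators = \<lparr>carrier = {A. (\<forall>f g. A (\<lambda>u. f u + g u) = (\<lambda>u. A f u + A g u)) \<and>
       (\<forall>c f. A (\<lambda>u. c * f u) = (\<lambda>u. c * A f u))},
     mult = (\<circ>), one = id, zero = (\<lambda>f u. 0), add = (\<lambda>A B f u. A f u + B f u),
     smult = (\<lambda>c A f u. c * A f u)\<rparr>"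

lemma linear_operators_simps [simp]:
  "mult linear_operators = (\<circ>)" "one linear_operators = id" "zero linear_operators = (\<lambda>f u. 0)"
  "add linear_operators = (\<lambda>A B f u. A f u + B f u)"
  "smult linear_operators = (\<lambda>c A f u. c * A f u)"
  "A \<in> carrier linear_operators \<longleftrightarrow> (\<forall>f g. A (\<lambda>u. f u + g u) = (\<lambda>u. A f u + A g u)) \<and>
       (\<forall>c f. A (\<lambda>u. c * f u) = (\<lambda>u. c * A f u))"
  by (simp_all add: linear_operators_def)

lemma complex_algebra_linear_operators: "complex_algebra linear_operators"
proof -
  have neg: "\<exists>B\<in>carrier linear_operators. B \<oplus>\<^bsub>linear_operators\<^esub> A = \<zero>\<^bsub>linear_operators\<^esub>"
    if "A \<in> carrier linear_operators" for A
    using that by (intro bexI[of _ "\<lambda>f u. - A f u"]) (auto simp: fun_eq_iff)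
  have "ring linear_operators"
  proof (rule ringI)
    show "abelian_group linear_operators"
      by (rule abelian_groupI) (use neg in \<open>auto simp: algebra_simps\<close>)
    show "Group.monoid linear_operators"
      by (rule monoidI) auto
  qed (auto simp: fun_eq_iff)
  then interpret ring linear_operators .
  show ?thesis
    by unfold_locales (auto simp: fun_eq_iff algebra_simps)
qed

interpretation Op: complex_algebra linear_operators
  by (rule complex_algebra_linear_operators)

text \<open>\<open>W\<close> translates by \<open>hbar\<close>. Moving it past multiplication by u
  turns u into u + hbar, and moving it past e^u produces the factor e^hbar, which are the defining
  commutation rules.\<close>

fun shift_rep :: "real \<Rightarrow> cat_gen \<Rightarrow> operator" where
  "shift_rep hbar gU = (\<lambda>f u. of_real u * f u)"
| "shift_rep hbar gR = (\<lambda>f u. of_real (exp u) * f u)"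
| "shift_rep hbar gRi = (\<lambda>f u. of_real (exp (- u)) * f u)"
| "shift_rep hbar gW = (\<lambda>f u. f (u + hbar))"
| "shift_rep hbar gWi = (\<lambda>f u. f (u - hbar))"

lemma cat_solution_shift_rep: "cat_solution hbar linear_operators (shift_rep hbar)"
proof -
  have "shift_rep hbar g \<in> carrier linear_operators" for g
    by (cases g) (auto simp: fun_eq_iff algebra_simps)
  then have closed: "range (shift_rep hbar) \<subseteq> carrier linear_operators"
    by blast
  have inv: "complex_of_real (exp u) * complex_of_real (exp (- u)) = 1" for u
    by (simp add: exp_minus flip: of_real_mult)
  show ?thesis
    using closed unfolding cat_solution_def Let_def
    by (simp add: fun_eq_iff inv inv[simplified mult.commute] exp_add exp_diff exp_minus field_simps)
qed

definition rep :: "real \<Rightarrow> cat_gen falg set \<Rightarrow> operator" where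
  "rep hbar = (SOME F. F \<in> algebra_hom (Cat hbar) linear_operators \<and>
     (\<forall>g. F (cat hbar g) = shift_rep hbar g))"

lemma rep:
  shows rep_hom: "rep hbar \<in> algebra_hom (Cat hbar) linear_operators"
    and rep_gen: "rep hbar (cat hbar g) = shift_rep hbar g"
proof -
  have "\<exists>F. F \<in> algebra_hom (Cat hbar) linear_operators \<and> (\<forall>g. F (cat hbar g) = shift_rep hbar g)"
    using Cat_universal_property[OF complex_algebra_linear_operators cat_solution_shift_rep] by metis
  from someI_ex[OF this]
  show "rep hbar \<in> algebra_hom (Cat hbar) linear_operators"
    "rep hbar (cat hbar g) = shift_rep hbar g"
    by (auto simp: rep_def)
qed

text \<open>Membership in \<open>Cinf\<close> asks for derivatives of all orders; this algebra of
  functions is stable under differentiation and contains all values of \<open>phi\<close>.\<close>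

inductive_set exp_polynomials :: "(real \<Rightarrow> complex) set" where
  const: "(\<lambda>u. c) \<in> exp_polynomials"
| ident: "(\<lambda>u. of_real u) \<in> exp_polynomials"
| exp: "(\<lambda>u. of_real (exp u)) \<in> exp_polynomials"
| exp_uminus: "(\<lambda>u. of_real (exp (- u))) \<in> exp_polynomials"
| add: "f \<in> exp_polynomials \<Longrightarrow> g \<in> exp_polynomials \<Longrightarrow> (\<lambda>u. f u + g u) \<in> exp_polynomials"
| mult: "f \<in> exp_polynomials \<Longrightarrow> g \<in> exp_polynomials \<Longrightarrow> (\<lambda>u. f u * g u) \<in> exp_polynomials"

lemma exp_polynomials_derivative:
  "f \<in> exp_polynomials \<Longrightarrow>
    \<exists>f'. f' \<in> exp_polynomials \<and> (\<forall>x. (f has_vector_derivative f' x) (at x))"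
proof (induction rule: exp_polynomials.induct)
  case (const c)
  then show ?case
    by (intro exI[of _ "\<lambda>u. 0"]) (auto intro: exp_polynomials.intros)
next
  case ident
  have "((\<lambda>u. complex_of_real u) has_vector_derivative of_real 1) (at x)" for x
    by (intro has_vector_derivative_of_real) simp
  then show ?case
    by (intro exI[of _ "\<lambda>u. 1"]) (auto intro: exp_polynomials.intros)
next
  case exp
  have "((\<lambda>u. complex_of_real (exp u)) has_vector_derivative of_real (exp x)) (at x)" for x
    by (intro has_vector_derivative_of_real) (auto intro: DERIV_exp)
  then show ?case
    by (intro exI[of _ "\<lambda>u. of_real (exp u)"]) (auto intro: exp_polynomials.intros)
next
  case exp_uminus
  have "((\<lambda>u. complex_of_real (exp (- u))) has_vector_derivative of_real (- exp (- x))) (at x)" for x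
    by (intro has_vector_derivative_of_real) (auto intro!: derivative_eq_intros)
  \<comment> \<open>The sign is written as a constant factor so that the clauses
    \<open>const\<close> and \<open>mult\<close> apply.\<close>
  then have "((\<lambda>u. complex_of_real (exp (- u))) has_vector_derivative (-1) * of_real (exp (- x))) (at x)" for x
    by simp
  then show ?case
    by (intro exI[of _ "\<lambda>u. (-1) * of_real (exp (- u))"])
      (intro conjI allI exp_polynomials.intros)
next
  case (add f g)
  then obtain f' g' where "f' \<in> exp_polynomials" "g' \<in> exp_polynomials"
    "\<And>x. (f has_vector_derivative f' x) (at x)" "\<And>x. (g has_vector_derivative g' x) (at x)"
    by blast
  then show ?case
    by (intro exI[of _ "\<lambda>u. f' u + g' u"])
      (auto intro: exp_polynomials.intros has_vector_derivative_add)
next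
  case (mult f g)
  then obtain f' g' where "f' \<in> exp_polynomials" "g' \<in> exp_polynomials"
    "\<And>x. (f has_vector_derivative f' x) (at x)" "\<And>x. (g has_vector_derivative g' x) (at x)"
    by blast
  with mult.hyps show ?case
    by (intro exI[of _ "\<lambda>u. f u * g' u + f' u * g u"])
      (auto intro!: exp_polynomials.intros(5,6) has_vector_derivative_mult)
qed

lemma exp_polynomials_smooth:
  assumes "f \<in> exp_polynomials"
  shows "smooth f"
proof -
  \<comment> \<open>A fixed choice of derivative within the class; its iterates form the sequence
    that \<open>smooth\<close> requires.\<close>
  obtain d where d: "\<And>f. f \<in> exp_polynomials \<Longrightarrow> d f \<in> exp_polynomials"
    "\<And>f x. f \<in> exp_polynomials \<Longrightarrow> (f has_vector_derivative d f x) (at x)"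
    using exp_polynomials_derivative by metis
  have "(d ^^ n) f \<in> exp_polynomials" for n
    by (induction n) (auto simp: assms d(1))
  then show ?thesis
    unfolding smooth_def by (intro exI[of _ "\<lambda>n. (d ^^ n) f"]) (simp add: d(2))
qed

lemma Cinf_simps [simp]:
  "f \<in> carrier Cinf \<longleftrightarrow> smooth f" "mult Cinf = (\<lambda>f g u. f u * g u)" "one Cinf = (\<lambda>u. 1)"
  "add Cinf = (\<lambda>f g u. f u + g u)" "smult Cinf = (\<lambda>c f u. c * f u)"
  by (simp_all add: Cinf_def)

text \<open>Multiplication operators are closed under sums and composition, and the three generators
  act by them. The multiplier is recovered by applying the operator to the constant function
  1.\<close>

lemma rep_ZUR:
  assumes "x \<in> ZUR hbar"
  shows "rep hbar x (\<lambda>u. 1) \<in> exp_polynomials \<and> (\<forall>g u. rep hbar x g u = rep hbar x (\<lambda>u. 1) u * g u)"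
  using assms
proof (induction rule: ZUR_induct)
  case (scalar c)
  then show ?case
    by (auto simp: algebra_homD[OF rep_hom] intro: exp_polynomials.intros)
next
  case (gen g)
  then show ?case
    by (auto simp: rep_gen intro: exp_polynomials.intros)
next
  case (add x y)
  have xy: "rep hbar (x \<oplus>\<^bsub>Cat hbar\<^esub> y) g = (\<lambda>u. rep hbar x g u + rep hbar y g u)" for g
    using add.hyps by (simp add: algebra_homD[OF rep_hom] ZUR_carrier)
  show ?case
    unfolding xy
  proof (intro conjI allI exp_polynomials.intros)
    fix g u
    have "rep hbar x g u = rep hbar x (\<lambda>u. 1) u * g u" "rep hbar y g u = rep hbar y (\<lambda>u. 1) u * g u"
      using add.IH by blast+
    then show "rep hbar x g u + rep hbar y g u =
        (rep hbar x (\<lambda>u. 1) u + rep hbar y (\<lambda>u. 1) u) * g u"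
      by (simp only: distrib_right)
  qed (use add.IH in blast)+
next
  case (mult x y)
  have xy: "rep hbar (x \<otimes>\<^bsub>Cat hbar\<^esub> y) g = (\<lambda>u. rep hbar x (\<lambda>u. 1) u * rep hbar y g u)" for g
  proof -
    have "rep hbar (x \<otimes>\<^bsub>Cat hbar\<^esub> y) g = rep hbar x (rep hbar y g)"
      using mult.hyps by (simp add: algebra_homD[OF rep_hom] ZUR_carrier)
    then show ?thesis
      using mult.IH(1) by (intro ext) metis
  qed
  show ?case
    unfolding xy
  proof (intro conjI allI exp_polynomials.intros)
    fix g u
    have "rep hbar y g u = rep hbar y (\<lambda>u. 1) u * g u"
      using mult.IH by blast
    then show "rep hbar x (\<lambda>u. 1) u * rep hbar y g u =
        (rep hbar x (\<lambda>u. 1) u * rep hbar y (\<lambda>u. 1) u) * g u"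
      by (simp only: mult.assoc)
  qed (use mult.IH in blast)+
qed

section \<open>Existence and uniqueness of the homomorphism phi\<close>

definition is_phi :: "real \<Rightarrow> (cat_gen falg set \<Rightarrow> real \<Rightarrow> complex) \<Rightarrow> bool" where
  "is_phi hbar \<phi> \<longleftrightarrow> \<phi> \<in> extensional (ZUR hbar) \<and> \<phi> \<in> algebra_hom (Cat hbar\<lparr>carrier := ZUR hbar\<rparr>) Cinf \<and>
     \<phi> (cat hbar gU) = (\<lambda>u. complex_of_real u) \<and>
     \<phi> (cat hbar gR) = (\<lambda>u. complex_of_real (exp u)) \<and>
     \<phi> (cat hbar gRi) = (\<lambda>u. complex_of_real (exp (- u)))"

text \<open>Composing multiplication operators multiplies their multipliers, so applying
  \<open>rep\<close> to the constant function 1 is multiplicative on \<open>ZUR\<close>; on all of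
  \<open>Cat hbar\<close> it need not be.\<close>

lemma is_phi_exists: "is_phi hbar (restrict (\<lambda>x. rep hbar x (\<lambda>u. 1)) (ZUR hbar))"
proof -
  have "rep hbar (x \<otimes>\<^bsub>Cat hbar\<^esub> y) (\<lambda>u. 1) = (\<lambda>u. rep hbar x (\<lambda>u. 1) u * rep hbar y (\<lambda>u. 1) u)"
    if "x \<in> ZUR hbar" "y \<in> ZUR hbar" for x y
  proof -
    have "rep hbar (x \<otimes>\<^bsub>Cat hbar\<^esub> y) (\<lambda>u. 1) = rep hbar x (rep hbar y (\<lambda>u. 1))"
      using that by (simp add: algebra_homD[OF rep_hom] ZUR_carrier)
    then show ?thesis
      using rep_ZUR[OF that(1)] by (intro ext) metis
  qed
  moreover have "smooth (rep hbar x (\<lambda>u. 1))" if "x \<in> ZUR hbar" for x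
    using rep_ZUR[OF that] exp_polynomials_smooth by blast
  ultimately show ?thesis
    unfolding is_phi_def algebra_hom_def
    by (auto intro!: ring_hom_memI simp: algebra_homD[OF rep_hom] ZUR_carrier ZUR_closed ZUR_smult rep_gen)
qed

lemma is_phi_unique:
  assumes "is_phi hbar \<phi>" "is_phi hbar \<psi>"
  shows "\<phi> = \<psi>"
proof (rule extensionalityI[of _ "ZUR hbar"])
  show "\<phi> \<in> extensional (ZUR hbar)" "\<psi> \<in> extensional (ZUR hbar)"
    using assms by (simp_all add: is_phi_def)
  have hom: "\<phi> \<in> algebra_hom (Cat hbar\<lparr>carrier := ZUR hbar\<rparr>) Cinf"
      "\<psi> \<in> algebra_hom (Cat hbar\<lparr>carrier := ZUR hbar\<rparr>) Cinf"
    using assms by (simp_all add: is_phi_def)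
  note h = algebra_homD[OF hom(1), simplified] algebra_homD[OF hom(2), simplified]
  fix x assume "x \<in> ZUR hbar"
  then show "\<phi> x = \<psi> x"
  proof (induction rule: ZUR_induct)
    case (gen g)
    then show ?case
      using assms by (auto simp: is_phi_def)
  qed (simp_all add: h ZUR_one)
qed

lemma is_phi_phi: "is_phi hbar (phi hbar)"
proof -
  have "\<exists>!\<phi>. is_phi hbar \<phi>"
    using is_phi_exists is_phi_unique by blast
  from theI'[OF this] show ?thesis
    by (simp add: phi_def is_phi_def)
qed

lemma phi_gen:
  "phi hbar (cat hbar gU) = (\<lambda>u. of_real u)"
  "phi hbar (cat hbar gR) = (\<lambda>u. of_real (exp u))"
  "phi hbar (cat hbar gRi) = (\<lambda>u. of_real (exp (- u)))"
  using is_phi_phi by (simp_all add: is_phi_def)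

lemma phi_hom:
  shows "x \<in> ZUR hbar \<Longrightarrow> y \<in> ZUR hbar \<Longrightarrow>
      phi hbar (x \<otimes>\<^bsub>Cat hbar\<^esub> y) = (\<lambda>u. phi hbar x u * phi hbar y u)"
    and "x \<in> ZUR hbar \<Longrightarrow> y \<in> ZUR hbar \<Longrightarrow>
      phi hbar (x \<oplus>\<^bsub>Cat hbar\<^esub> y) = (\<lambda>u. phi hbar x u + phi hbar y u)"
    and "x \<in> ZUR hbar \<Longrightarrow> phi hbar (c \<odot>\<^bsub>Cat hbar\<^esub> x) = (\<lambda>u. c * phi hbar x u)"
    and "phi hbar \<one>\<^bsub>Cat hbar\<^esub> = (\<lambda>u. 1)"
proof -
  have "phi hbar \<in> algebra_hom (Cat hbar\<lparr>carrier := ZUR hbar\<rparr>) Cinf"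
    using is_phi_phi by (simp add: is_phi_def)
  note h = algebra_homD[OF this, simplified]
  show "x \<in> ZUR hbar \<Longrightarrow> y \<in> ZUR hbar \<Longrightarrow>
      phi hbar (x \<otimes>\<^bsub>Cat hbar\<^esub> y) = (\<lambda>u. phi hbar x u * phi hbar y u)"
    "x \<in> ZUR hbar \<Longrightarrow> y \<in> ZUR hbar \<Longrightarrow>
      phi hbar (x \<oplus>\<^bsub>Cat hbar\<^esub> y) = (\<lambda>u. phi hbar x u + phi hbar y u)"
    "x \<in> ZUR hbar \<Longrightarrow> phi hbar (c \<odot>\<^bsub>Cat hbar\<^esub> x) = (\<lambda>u. c * phi hbar x u)"
    "phi hbar \<one>\<^bsub>Cat hbar\<^esub> = (\<lambda>u. 1)"
    by (simp_all add: h)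
qed

section \<open>The localized algebra\<close>

lemma localization_Hat: "localization UNIV (cat_relations hbar) (Zplus hbar)"
proof -
  interpret presentation UNIV "cat_relations hbar" by (rule presentation_cat)
  show ?thesis
    by standard (auto simp: Zplus_def Cat_def[symmetric] intro: ZUR_carrier)
qed

lemma Hat_eq: "Hat hbar = presented_algebra (loc_letters UNIV (Zplus hbar))
    (loc_relations (cat_relations hbar) (Zplus hbar))"
  by (simp add: Hat_def universal_localization_def)

lemma hgen_eq: "localization.gen UNIV (cat_relations hbar) (Zplus hbar) = hgen hbar"
  by (simp add: localization.gen_def[OF localization_Hat] hgen_def fun_eq_iff)

lemma complex_algebra_Hat: "complex_algebra (Hat hbar)"
proof -
  interpret localization UNIV "cat_relations hbar" "Zplus hbar" by (rule localization_Hat)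
  show ?thesis
    unfolding Hat_eq by (rule L.P.complex_algebra_axioms)
qed

interpretation Hat: complex_algebra "Hat hbar" for hbar
  by (rule complex_algebra_Hat)

lemma hgen_closed [simp]: "hgen hbar g \<in> carrier (Hat hbar)"
  using localization.gen_closed[OF localization_Hat] by (simp add: hgen_eq Hat_eq)

lemma cat_solution_hgen: "cat_solution hbar (Hat hbar) (hgen hbar)"
proof -
  have "range (hgen hbar) \<subseteq> carrier (Hat hbar)"
    by auto
  then show ?thesis
    using localization.value_gen_rel[OF localization_Hat[of hbar], unfolded hgen_eq, folded Hat_eq]
    by (auto simp: cat_solution_iff[OF complex_algebra_Hat])
qed

lemma
  shows W_Wi: "hgen hbar gW \<otimes>\<^bsub>Hat hbar\<^esub> hgen hbar gWi = \<one>\<^bsub>Hat hbar\<^esub>"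
    and Wi_W: "hgen hbar gWi \<otimes>\<^bsub>Hat hbar\<^esub> hgen hbar gW = \<one>\<^bsub>Hat hbar\<^esub>"
    and R_Ri: "hgen hbar gR \<otimes>\<^bsub>Hat hbar\<^esub> hgen hbar gRi = \<one>\<^bsub>Hat hbar\<^esub>"
    and Ri_R: "hgen hbar gRi \<otimes>\<^bsub>Hat hbar\<^esub> hgen hbar gR = \<one>\<^bsub>Hat hbar\<^esub>"
    and R_U: "hgen hbar gR \<otimes>\<^bsub>Hat hbar\<^esub> hgen hbar gU = hgen hbar gU \<otimes>\<^bsub>Hat hbar\<^esub> hgen hbar gR"
    and Ri_U: "hgen hbar gRi \<otimes>\<^bsub>Hat hbar\<^esub> hgen hbar gU = hgen hbar gU \<otimes>\<^bsub>Hat hbar\<^esub> hgen hbar gRi"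
    and W_R: "hgen hbar gW \<otimes>\<^bsub>Hat hbar\<^esub> hgen hbar gR =
      of_real (exp hbar) \<odot>\<^bsub>Hat hbar\<^esub> (hgen hbar gR \<otimes>\<^bsub>Hat hbar\<^esub> hgen hbar gW)"
    and W_Ri: "hgen hbar gW \<otimes>\<^bsub>Hat hbar\<^esub> hgen hbar gRi =
      of_real (exp (- hbar)) \<odot>\<^bsub>Hat hbar\<^esub> (hgen hbar gRi \<otimes>\<^bsub>Hat hbar\<^esub> hgen hbar gW)"
    and Wi_R: "hgen hbar gWi \<otimes>\<^bsub>Hat hbar\<^esub> hgen hbar gR =
      of_real (exp (- hbar)) \<odot>\<^bsub>Hat hbar\<^esub> (hgen hbar gR \<otimes>\<^bsub>Hat hbar\<^esub> hgen hbar gWi)"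
    and Wi_Ri: "hgen hbar gWi \<otimes>\<^bsub>Hat hbar\<^esub> hgen hbar gRi =
      of_real (exp hbar) \<odot>\<^bsub>Hat hbar\<^esub> (hgen hbar gRi \<otimes>\<^bsub>Hat hbar\<^esub> hgen hbar gWi)"
    and W_U: "hgen hbar gW \<otimes>\<^bsub>Hat hbar\<^esub> hgen hbar gU =
      (hgen hbar gU \<otimes>\<^bsub>Hat hbar\<^esub> hgen hbar gW) \<oplus>\<^bsub>Hat hbar\<^esub> (of_real hbar \<odot>\<^bsub>Hat hbar\<^esub> hgen hbar gW)"
    and Wi_U: "hgen hbar gWi \<otimes>\<^bsub>Hat hbar\<^esub> hgen hbar gU =
      (hgen hbar gU \<otimes>\<^bsub>Hat hbar\<^esub> hgen hbar gWi) \<oplus>\<^bsub>Hat hbar\<^esub> ((- of_real hbar) \<odot>\<^bsub>Hat hbar\<^esub> hgen hbar gWi)"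
  using cat_solution_hgen[of hbar] unfolding cat_solution_def Let_def by blast+

lemmas hgen_relations = W_Wi Wi_W R_Ri Ri_R R_U Ri_U W_R W_Ri Wi_R Wi_Ri W_U Wi_U

section \<open>The canonical map into the localization and the universal property\<close>

definition iota :: "real \<Rightarrow> cat_gen falg set \<Rightarrow> hat" where
  "iota hbar = (SOME F. F \<in> algebra_hom (Cat hbar) (Hat hbar) \<and>
     (\<forall>g. F (cat hbar g) = hgen hbar g) \<and> (\<forall>s\<in>Zplus hbar. F s \<in> Units (Hat hbar)))"

lemma iota:
  shows iota_hom: "iota hbar \<in> algebra_hom (Cat hbar) (Hat hbar)"
    and iota_cat: "iota hbar (cat hbar g) = hgen hbar g"
    and iota_Zplus: "s \<in> Zplus hbar \<Longrightarrow> iota hbar s \<in> Units (Hat hbar)"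
proof -
  obtain F where F: "F \<in> algebra_hom (Cat hbar) (Hat hbar)"
    "\<And>p. F (alg_class UNIV (cat_relations hbar) p) = falg_value (Hat hbar) (hgen hbar) p"
    "\<And>s. s \<in> Zplus hbar \<Longrightarrow> F s \<in> Units (Hat hbar)"
    using localization.localization_map_exists[OF localization_Hat[of hbar]]
    unfolding hgen_eq Hat_eq[symmetric] Cat_def[symmetric]
    by (auto simp: free_algebra_def)
  have "F (cat hbar g) = hgen hbar g" for g
    by (simp add: cat_def F(2))
  with F have "\<exists>F. F \<in> algebra_hom (Cat hbar) (Hat hbar) \<and>
     (\<forall>g. F (cat hbar g) = hgen hbar g) \<and> (\<forall>s\<in>Zplus hbar. F s \<in> Units (Hat hbar))"
    by blast
  from someI_ex[OF this] show "iota hbar \<in> algebra_hom (Cat hbar) (Hat hbar)"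
    "iota hbar (cat hbar g) = hgen hbar g"
    "s \<in> Zplus hbar \<Longrightarrow> iota hbar s \<in> Units (Hat hbar)"
    unfolding iota_def by blast+
qed

text \<open>The unit condition quantifies over all homomorphisms with the prescribed values, so that
  it can be verified for the induced map without constructing that map first.\<close>

lemma Hat_universal_property:
  assumes "complex_algebra B" "cat_solution hbar B f"
    and units: "\<And>F s. F \<in> algebra_hom (Cat hbar) B \<Longrightarrow> (\<And>g. F (cat hbar g) = f g) \<Longrightarrow>
      s \<in> Zplus hbar \<Longrightarrow> F s \<in> Units B"
  obtains G where "G \<in> algebra_hom (Hat hbar) B" "\<And>g. G (hgen hbar g) = f g"
proof -
  obtain F where F: "F \<in> algebra_hom (Cat hbar) B" "\<And>g. F (cat hbar g) = f g"
    "\<And>p. F (alg_class UNIV (cat_relations hbar) p) = falg_value B f p"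
    using Cat_universal_property[OF assms(1,2)] by blast
  have "f g \<in> carrier B" for g
    using assms(2) by (auto simp: cat_solution_def)
  then obtain G where "G \<in> algebra_hom (Hat hbar) B" "\<And>g. G (hgen hbar g) = f g"
    using localization.localization_universal_property[OF localization_Hat[of hbar] assms(1), of f F]
      F(3) units[OF F(1,2)]
    unfolding hgen_eq Hat_eq[symmetric] by auto
  with that show thesis
    by blast
qed

text \<open>\<open>gRi\<close> and \<open>gWi\<close> name inverses of \<open>gR\<close> and
  \<open>gW\<close>, so the inversion rule reaches them; what remains are exactly the three
  generators on which \<open>star\<close> and \<open>partials\<close> are prescribed.\<close>

lemma Hat_induct [consumes 1, case_names scalar add mult inverse U R W]:
  assumes "x \<in> carrier (Hat hbar)"
    and scalar: "\<And>c. P (c \<odot>\<^bsub>Hat hbar\<^esub> \<one>\<^bsub>Hat hbar\<^esub>)"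
    and add: "\<And>x y. x \<in> carrier (Hat hbar) \<Longrightarrow> y \<in> carrier (Hat hbar) \<Longrightarrow> P x \<Longrightarrow> P y \<Longrightarrow>
      P (x \<oplus>\<^bsub>Hat hbar\<^esub> y)"
    and mult: "\<And>x y. x \<in> carrier (Hat hbar) \<Longrightarrow> y \<in> carrier (Hat hbar) \<Longrightarrow> P x \<Longrightarrow> P y \<Longrightarrow>
      P (x \<otimes>\<^bsub>Hat hbar\<^esub> y)"
    and inverse: "\<And>x y. x \<in> carrier (Hat hbar) \<Longrightarrow> y \<in> carrier (Hat hbar) \<Longrightarrow>
      x \<otimes>\<^bsub>Hat hbar\<^esub> y = \<one>\<^bsub>Hat hbar\<^esub> \<Longrightarrow> y \<otimes>\<^bsub>Hat hbar\<^esub> x = \<one>\<^bsub>Hat hbar\<^esub> \<Longrightarrow> P x \<Longrightarrow> P y"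
    and gens: "P (hgen hbar gU)" "P (hgen hbar gR)" "P (hgen hbar gW)"
  shows "P x"
proof -
  have "P (hgen hbar gRi)" "P (hgen hbar gWi)"
    by (rule inverse[OF hgen_closed hgen_closed], fact R_Ri, fact Ri_R, fact gens,
        rule inverse[OF hgen_closed hgen_closed], fact W_Wi, fact Wi_W, fact gens)
  with gens have gen: "P (hgen hbar g)" for g
    by (cases g) auto
  show ?thesis
    by (rule localization.localization_induct[OF localization_Hat, folded Hat_eq, unfolded hgen_eq])
      (use assms(1) scalar add mult inverse gen in auto)
qed


subsection \<open>The involution\<close>

text \<open>With this target, an antilinear map that reverses products is an ordinary
  \<open>algebra_hom\<close>.\<close>

definition conj_opposite :: "(complex, 'a) module \<Rightarrow> (complex, 'a) module" where
  "conj_opposite A = \<lparr>carrier = carrier A, mult = (\<lambda>x y. y \<otimes>\<^bsub>A\<^esub> x), one = \<one>\<^bsub>A\<^esub>, zero = \<zero>\<^bsub>A\<^esub>,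
     add = add A, smult = (\<lambda>c x. cnj c \<odot>\<^bsub>A\<^esub> x)\<rparr>"

lemma conj_opposite_simps [simp]:
  "carrier (conj_opposite A) = carrier A" "mult (conj_opposite A) = (\<lambda>x y. y \<otimes>\<^bsub>A\<^esub> x)"
  "one (conj_opposite A) = \<one>\<^bsub>A\<^esub>" "zero (conj_opposite A) = \<zero>\<^bsub>A\<^esub>"
  "add (conj_opposite A) = add A" "smult (conj_opposite A) = (\<lambda>c x. cnj c \<odot>\<^bsub>A\<^esub> x)"
  by (simp_all add: conj_opposite_def)

lemma (in complex_algebra) complex_algebra_conj_opposite: "complex_algebra (conj_opposite A)"
proof -
  have "ring (conj_opposite A)"
  proof (rule ringI)
    show "abelian_group (conj_opposite A)"
      by (rule abelian_groupI) (auto simp: a_ac add.l_inv_ex)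
    show "Group.monoid (conj_opposite A)"
      by (rule monoidI) (auto simp: m_assoc)
  qed (auto simp: l_distr r_distr)
  then interpret op: ring "conj_opposite A" .
  show ?thesis
    by unfold_locales (auto simp: smult_l_distr smult_r_distr smult_mult_left smult_mult_right)
qed

lemma Units_conj_opposite [simp]: "Units (conj_opposite A) = Units A"
  by (auto simp: Units_def)

fun star_gen :: "cat_gen \<Rightarrow> cat_gen" where
  "star_gen gU = gU" | "star_gen gR = gR" | "star_gen gRi = gRi" | "star_gen gW = gWi" | "star_gen gWi = gW"

lemma exp_cancel:
  "complex_of_real (exp x) * complex_of_real (exp (- x)) = 1"
  "complex_of_real (exp (- x)) * complex_of_real (exp x) = 1"
  by (simp_all flip: of_real_mult exp_add)

text \<open>The coefficients are real, so conjugation keeps them. In reversed order the rule for W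
  and R reads R W^{-1} = e^hbar W^{-1} R, which is the rule for W^{-1} and R solved for the other
  product; \<open>exp_cancel\<close> removes the factors.\<close>

lemma cat_solution_star:
  "cat_solution hbar (conj_opposite (Hat hbar)) (\<lambda>g. hgen hbar (star_gen g))"
  unfolding cat_solution_def Let_def
  by (simp add: image_subset_iff hgen_relations exp_cancel Hat.a_assoc
      flip: Hat.smult_l_distr)

definition is_star :: "real \<Rightarrow> (hat \<Rightarrow> hat) \<Rightarrow> bool" where
  "is_star hbar s \<longleftrightarrow> s \<in> extensional (carrier (Hat hbar)) \<and> involution (Hat hbar) s \<and>
     s (hgen hbar gU) = hgen hbar gU \<and> s (hgen hbar gR) = hgen hbar gR \<and> s (hgen hbar gW) = hgen hbar gWi"

lemma involutionD:
  assumes "involution A s"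
  shows "x \<in> carrier A \<Longrightarrow> s x \<in> carrier A"
    "x \<in> carrier A \<Longrightarrow> y \<in> carrier A \<Longrightarrow> s (x \<oplus>\<^bsub>A\<^esub> y) = s x \<oplus>\<^bsub>A\<^esub> s y"
    "x \<in> carrier A \<Longrightarrow> y \<in> carrier A \<Longrightarrow> s (x \<otimes>\<^bsub>A\<^esub> y) = s y \<otimes>\<^bsub>A\<^esub> s x"
    "x \<in> carrier A \<Longrightarrow> s (c \<odot>\<^bsub>A\<^esub> x) = cnj c \<odot>\<^bsub>A\<^esub> s x"
    "x \<in> carrier A \<Longrightarrow> s (s x) = x"
  using assms by (auto simp: involution_def)

text \<open>Applying \<open>s\<close> to the product of \<open>s \<one>\<close> and
  \<open>\<one>\<close> gives \<open>s (s \<one>) = s \<one> \<otimes> s (s \<one>)\<close>, and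
  \<open>s (s \<one>)\<close> is \<open>\<one>\<close>.\<close>

lemma (in complex_algebra) involution_one:
  assumes "involution A s"
  shows "s \<one> = \<one>"
proof -
  note s = involutionD[OF assms]
  show ?thesis
    using s(3)[of "s \<one>" \<one>] by (simp add: s(1,5))
qed

lemma (in complex_algebra) involution_inverse:
  assumes "involution A s" "x \<in> carrier A" "y \<in> carrier A" "x \<otimes> y = \<one>" "y \<otimes> x = \<one>"
  shows "s y \<otimes> s x = \<one>" "s x \<otimes> s y = \<one>"
  using assms involution_one[OF assms(1)] by (simp_all flip: involutionD(3)[OF assms(1)])

text \<open>The image of \<open>x\<close> under \<open>F\<close> comes from an element
  \<open>t\<close> of \<open>ZUR\<close> that plays the role of x^*, and its function is the complex
  conjugate of that of \<open>x\<close>. Conjugation creates no zeros, so for \<open>s\<close> in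
  \<open>Zplus\<close> this element is again in \<open>Zplus\<close>.\<close>

lemma star_preserves_Zplus:
  assumes F: "F \<in> algebra_hom (Cat hbar) (conj_opposite (Hat hbar))"
    and gens: "\<And>g. F (cat hbar g) = hgen hbar (star_gen g)"
    and s: "s \<in> Zplus hbar"
  shows "F s \<in> Units (Hat hbar)"
proof -
  note hF = algebra_homD[OF F, simplified] and hi = algebra_homD[OF iota_hom]
  \<comment> \<open>The element \<open>t\<close> is built along the induction, which avoids a
    separate construction of the involution on \<open>Cat hbar\<close>.\<close>
  have "\<exists>t\<in>ZUR hbar. F x = iota hbar t \<and> phi hbar t = (\<lambda>u. cnj (phi hbar x u))"
    if "x \<in> ZUR hbar" for x
    using that
  proof (induction rule: ZUR_induct)
    case (scalar c)
    then show ?case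
      by (intro bexI[of _ "cnj c \<odot>\<^bsub>Cat hbar\<^esub> \<one>\<^bsub>Cat hbar\<^esub>"])
        (simp_all add: hF hi phi_hom ZUR_closed)
  next
    case (gen g)
    then show ?case
      by (intro bexI[of _ "cat hbar g"]) (auto simp: gens iota_cat phi_gen ZUR_gen)
  next
    case (add x y)
    then obtain t t' where "t \<in> ZUR hbar" "F x = iota hbar t" "phi hbar t = (\<lambda>u. cnj (phi hbar x u))"
      "t' \<in> ZUR hbar" "F y = iota hbar t'" "phi hbar t' = (\<lambda>u. cnj (phi hbar y u))"
      by blast
    with add.hyps show ?case
      by (intro bexI[of _ "t \<oplus>\<^bsub>Cat hbar\<^esub> t'"]) (simp_all add: hF hi phi_hom ZUR_closed)
  next
    case (mult x y)
    then obtain t t' where "t \<in> ZUR hbar" "F x = iota hbar t" "phi hbar t = (\<lambda>u. cnj (phi hbar x u))"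
      "t' \<in> ZUR hbar" "F y = iota hbar t'" "phi hbar t' = (\<lambda>u. cnj (phi hbar y u))"
      by blast
    with mult.hyps show ?case
      \<comment> \<open>\<open>F\<close> takes values in the opposite algebra, hence the reversed
        order; the functions themselves commute.\<close>
      by (intro bexI[of _ "t' \<otimes>\<^bsub>Cat hbar\<^esub> t"]) (simp_all add: hF hi phi_hom ZUR_closed mult.commute)
  qed
  moreover have "s \<in> ZUR hbar" "\<And>u. phi hbar s u \<noteq> 0"
    using s by (auto simp: Zplus_def)
  ultimately obtain t where "t \<in> ZUR hbar" "F s = iota hbar t" "\<And>u. phi hbar t u \<noteq> 0"
    by (metis complex_cnj_zero_iff)
  then have "t \<in> Zplus hbar" "F s = iota hbar t"
    by (auto simp: Zplus_def)
  then show ?thesis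
    using iota_Zplus by simp
qed

lemma is_star_exists: "\<exists>s. is_star hbar s"
proof -
  obtain G where G: "G \<in> algebra_hom (Hat hbar) (conj_opposite (Hat hbar))"
    "\<And>g. G (hgen hbar g) = hgen hbar (star_gen g)"
    using Hat_universal_property[OF Hat.complex_algebra_conj_opposite cat_solution_star]
      star_preserves_Zplus by (metis Units_conj_opposite)
  note hG = algebra_homD[OF G(1), simplified]
  \<comment> \<open>The square of \<open>G\<close> is linear and multiplicative and fixes the
    generators. For inverses, \<open>y\<close> is a left inverse and \<open>G (G y)\<close> a right
    inverse of the same \<open>x\<close>, so they agree.\<close>
  have "G (G x) = x" if "x \<in> carrier (Hat hbar)" for x
    using that
  proof (induction rule: Hat_induct)
    case (inverse x y)
    have "G (G (x \<otimes>\<^bsub>Hat hbar\<^esub> y)) = G (G x) \<otimes>\<^bsub>Hat hbar\<^esub> G (G y)"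
      using inverse.hyps(1,2) by (simp add: hG)
    then have "x \<otimes>\<^bsub>Hat hbar\<^esub> G (G y) = \<one>\<^bsub>Hat hbar\<^esub>"
      using inverse by (simp add: hG)
    from Hat.inv_unique[OF inverse.hyps(4) this] show ?case
      using inverse.hyps by (simp add: hG)
  qed (simp_all add: hG G(2))
  then have "is_star hbar (restrict G (carrier (Hat hbar)))"
    by (auto simp: is_star_def involution_def hG G(2))
  then show ?thesis
    by blast
qed

lemma is_star_unique:
  assumes "is_star hbar s" "is_star hbar s'"
  shows "s = s'"
proof (rule extensionalityI[of _ "carrier (Hat hbar)"])
  show "s \<in> extensional (carrier (Hat hbar))" "s' \<in> extensional (carrier (Hat hbar))"
    using assms by (simp_all add: is_star_def)
  have inv: "involution (Hat hbar) s" "involution (Hat hbar) s'"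
    using assms by (simp_all add: is_star_def)
  note h = involutionD[OF inv(1)] involutionD[OF inv(2)] Hat.involution_one[OF inv(1)] Hat.involution_one[OF inv(2)]
  fix x assume "x \<in> carrier (Hat hbar)"
  then show "s x = s' x"
  proof (induction rule: Hat_induct)
    case (inverse x y)
    \<comment> \<open>\<open>s y\<close> and \<open>s' y\<close> are a left and a right inverse of
      the common value \<open>s x = s' x\<close>.\<close>
    have "s y \<otimes>\<^bsub>Hat hbar\<^esub> s x = \<one>\<^bsub>Hat hbar\<^esub>" "s x \<otimes>\<^bsub>Hat hbar\<^esub> s' y = \<one>\<^bsub>Hat hbar\<^esub>"
      using inverse Hat.involution_inverse[OF inv(1), of x y] Hat.involution_inverse[OF inv(2), of x y]
      by auto
    from Hat.inv_unique[OF this] show ?case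
      using inverse.hyps by (simp add: h)
  qed (use assms in \<open>simp_all add: h is_star_def\<close>)
qed

lemma is_star_star: "is_star hbar (star hbar)"
proof -
  have "\<exists>!s. is_star hbar s"
    using is_star_exists is_star_unique by blast
  from theI'[OF this] show ?thesis
    by (simp add: star_def is_star_def)
qed

lemma involution_star: "involution (Hat hbar) (star hbar)"
  using is_star_star by (simp add: is_star_def)

lemmas star = involutionD[OF involution_star] Hat.involution_one[OF involution_star]

lemma star_hgen: "star hbar (hgen hbar g) = hgen hbar (star_gen g)"
proof -
  have *: "star hbar (hgen hbar gU) = hgen hbar gU" "star hbar (hgen hbar gR) = hgen hbar gR"
    "star hbar (hgen hbar gW) = hgen hbar gWi"
    using is_star_star by (simp_all add: is_star_def)
  have "hgen hbar gRi \<otimes>\<^bsub>Hat hbar\<^esub> hgen hbar gR = \<one>\<^bsub>Hat hbar\<^esub>"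
    by (rule Ri_R)
  moreover have "hgen hbar gR \<otimes>\<^bsub>Hat hbar\<^esub> star hbar (hgen hbar gRi) = \<one>\<^bsub>Hat hbar\<^esub>"
    using Hat.involution_inverse(2)[OF involution_star, of "hgen hbar gR" hbar "hgen hbar gRi"]
    by (simp add: R_Ri Ri_R *)
  ultimately have "star hbar (hgen hbar gRi) = hgen hbar gRi"
    using Hat.inv_unique by (metis hgen_closed star(1))
  moreover have "star hbar (hgen hbar gWi) = hgen hbar gW"
    using star(5)[of "hgen hbar gW" hbar] by (simp add: *)
  ultimately show ?thesis
    using * by (cases g) auto
qed

subsection \<open>Derivations\<close>

lemma derivationD:
  assumes "derivation A d"
  shows "x \<in> carrier A \<Longrightarrow> d x \<in> carrier A"
    "x \<in> carrier A \<Longrightarrow> y \<in> carrier A \<Longrightarrow> d (x \<oplus>\<^bsub>A\<^esub> y) = d x \<oplus>\<^bsub>A\<^esub> d y"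
    "x \<in> carrier A \<Longrightarrow> d (c \<odot>\<^bsub>A\<^esub> x) = c \<odot>\<^bsub>A\<^esub> d x"
    "x \<in> carrier A \<Longrightarrow> y \<in> carrier A \<Longrightarrow> d (x \<otimes>\<^bsub>A\<^esub> y) = (d x \<otimes>\<^bsub>A\<^esub> y) \<oplus>\<^bsub>A\<^esub> (x \<otimes>\<^bsub>A\<^esub> d y)"
  using assms by (auto simp: derivation_def)

context complex_algebra
begin

lemma derivation_one:
  assumes "derivation A d"
  shows "d \<one> = \<zero>"
  using derivationD(4)[OF assms, of \<one> \<one>] derivationD(1)[OF assms, of \<one>] by simp

lemma derivation_of_zero:
  assumes "derivation A d"
  shows "d \<zero> = \<zero>"
  using derivationD(2)[OF assms, of \<zero> \<zero>] derivationD(1)[OF assms, of \<zero>] by simp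

text \<open>Leibniz on x y = 1 gives x (d y) = - (d x) y; multiply by y from the left.\<close>

lemma derivation_inverse:
  assumes "derivation A d" "x \<in> carrier A" "y \<in> carrier A" "x \<otimes> y = \<one>" "y \<otimes> x = \<one>"
  shows "d y = \<ominus> (y \<otimes> d x \<otimes> y)"
proof -
  note d = derivationD[OF assms(1)]
  have *: "(d x \<otimes> y) \<oplus> (x \<otimes> d y) = \<zero>"
    using d(4)[OF assms(2,3)] assms(4) derivation_one[OF assms(1)] by simp
  have "d y = (y \<otimes> x) \<otimes> d y"
    using assms d(1) by simp
  also have "\<dots> = y \<otimes> ((d x \<otimes> y) \<oplus> (x \<otimes> d y)) \<ominus> y \<otimes> d x \<otimes> y"
    using assms(2,3) d(1) by algebra
  finally show ?thesis
    using assms(2,3) d(1) by (simp add: * a_minus_def)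
qed

text \<open>The two reversals of order and the two conjugations of scalars cancel. A derivation is
  hermitian iff it equals this conjugate, which turns hermiticity into a comparison of derivations
  on generators.\<close>

lemma derivation_conjugate:
  assumes "derivation A d" "involution A s"
  shows "derivation A (\<lambda>x. s (d (s x)))"
  unfolding derivation_def
  using derivationD[OF assms(1)] involutionD[OF assms(2)] by (auto simp: a_comm)

text \<open>Commuting of two derivations thus becomes a matter of generators: their commutator is to
  be compared with the zero derivation.\<close>

lemma derivation_commutator:
  assumes "derivation A d" "derivation A e"
  shows "derivation A (\<lambda>x. d (e x) \<ominus> e (d x))"
proof -
  note h = derivationD[OF assms(1)] derivationD[OF assms(2)]
  show ?thesis
    unfolding derivation_def
  proof (intro conjI ballI allI)
    show "(\<lambda>x. d (e x) \<ominus> e (d x)) \<in> carrier A \<rightarrow> carrier A"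
      by (simp add: h)
  next
    fix x y assume xy: "x \<in> carrier A" "y \<in> carrier A"
    have c: "d x \<in> carrier A" "d y \<in> carrier A" "e x \<in> carrier A" "e y \<in> carrier A"
      "d (e x) \<in> carrier A" "d (e y) \<in> carrier A" "e (d x) \<in> carrier A" "e (d y) \<in> carrier A"
      using xy by (simp_all add: h)
    have "d (e (x \<oplus> y)) \<ominus> e (d (x \<oplus> y)) = (d (e x) \<oplus> d (e y)) \<ominus> (e (d x) \<oplus> e (d y))"
      using xy by (simp add: h)
    also have "\<dots> = (d (e x) \<ominus> e (d x)) \<oplus> (d (e y) \<ominus> e (d y))"
      using c by algebra
    finally show "d (e (x \<oplus> y)) \<ominus> e (d (x \<oplus> y)) = (d (e x) \<ominus> e (d x)) \<oplus> (d (e y) \<ominus> e (d y))" .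
    have "d (e (x \<otimes> y)) \<ominus> e (d (x \<otimes> y)) =
       ((d (e x) \<otimes> y \<oplus> e x \<otimes> d y) \<oplus> (d x \<otimes> e y \<oplus> x \<otimes> d (e y))) \<ominus>
       ((e (d x) \<otimes> y \<oplus> d x \<otimes> e y) \<oplus> (e x \<otimes> d y \<oplus> x \<otimes> e (d y)))"
      using xy c by (simp add: h)
    \<comment> \<open>The mixed products of first derivatives occur in both terms and
      cancel.\<close>
    also have "\<dots> = ((d (e x) \<ominus> e (d x)) \<otimes> y) \<oplus> (x \<otimes> (d (e y) \<ominus> e (d y)))"
      using xy c by algebra
    finally show "d (e (x \<otimes> y)) \<ominus> e (d (x \<otimes> y)) =
       ((d (e x) \<ominus> e (d x)) \<otimes> y) \<oplus> (x \<otimes> (d (e y) \<ominus> e (d y)))" .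
  next
    fix x c assume "x \<in> carrier A"
    then show "d (e (c \<odot> x)) \<ominus> e (d (c \<odot> x)) = c \<odot> (d (e x) \<ominus> e (d x))"
      by (simp add: h a_minus_def smult_r_distr smult_minus_right)
  qed
qed

lemma derivation_zero: "derivation A (\<lambda>x. \<zero>)"
  by (simp add: derivation_def)

end

text \<open>A derivation \<open>d\<close> of \<open>A\<close> is the same as a homomorphism \<open>x \<mapsto> (x, d x)\<close> into the dual
  numbers over \<open>A\<close>, so derivations can be obtained from universal properties.\<close>

definition dual_numbers :: "(complex, 'a) module \<Rightarrow> (complex, 'a \<times> 'a) module" where
  "dual_numbers A = \<lparr>carrier = carrier A \<times> carrier A,
     mult = (\<lambda>(x, d) (y, e). (x \<otimes>\<^bsub>A\<^esub> y, (d \<otimes>\<^bsub>A\<^esub> y) \<oplus>\<^bsub>A\<^esub> (x \<otimes>\<^bsub>A\<^esub> e))),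
     one = (\<one>\<^bsub>A\<^esub>, \<zero>\<^bsub>A\<^esub>), zero = (\<zero>\<^bsub>A\<^esub>, \<zero>\<^bsub>A\<^esub>),
     add = (\<lambda>(x, d) (y, e). (x \<oplus>\<^bsub>A\<^esub> y, d \<oplus>\<^bsub>A\<^esub> e)),
     smult = (\<lambda>c (x, d). (c \<odot>\<^bsub>A\<^esub> x, c \<odot>\<^bsub>A\<^esub> d))\<rparr>"

lemma dual_numbers_simps [simp]:
  "carrier (dual_numbers A) = carrier A \<times> carrier A"
  "mult (dual_numbers A) p q = (fst p \<otimes>\<^bsub>A\<^esub> fst q, (snd p \<otimes>\<^bsub>A\<^esub> fst q) \<oplus>\<^bsub>A\<^esub> (fst p \<otimes>\<^bsub>A\<^esub> snd q))"
  "one (dual_numbers A) = (\<one>\<^bsub>A\<^esub>, \<zero>\<^bsub>A\<^esub>)" "zero (dual_numbers A) = (\<zero>\<^bsub>A\<^esub>, \<zero>\<^bsub>A\<^esub>)"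
  "add (dual_numbers A) p q = (fst p \<oplus>\<^bsub>A\<^esub> fst q, snd p \<oplus>\<^bsub>A\<^esub> snd q)"
  "smult (dual_numbers A) c p = (c \<odot>\<^bsub>A\<^esub> fst p, c \<odot>\<^bsub>A\<^esub> snd p)"
  by (simp_all add: dual_numbers_def case_prod_beta)

lemma (in complex_algebra) complex_algebra_dual_numbers: "complex_algebra (dual_numbers A)"
proof -
  have neg: "\<exists>q\<in>carrier (dual_numbers A). q \<oplus>\<^bsub>dual_numbers A\<^esub> p = \<zero>\<^bsub>dual_numbers A\<^esub>"
    if "p \<in> carrier (dual_numbers A)" for p
    using that by (intro bexI[of _ "(\<ominus> fst p, \<ominus> snd p)"]) (auto simp: l_neg)
  have "ring (dual_numbers A)"
  proof (rule ringI)
    show "abelian_group (dual_numbers A)"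
      by (rule abelian_groupI) (use neg in \<open>auto simp: a_ac\<close>)
    show "Group.monoid (dual_numbers A)"
      by (rule monoidI) (auto simp: m_assoc l_distr r_distr a_ac)
  qed (auto simp: l_distr r_distr a_ac)
  then interpret D: ring "dual_numbers A" .
  show ?thesis
    by unfold_locales
      (auto simp: smult_l_distr smult_r_distr smult_mult_left smult_mult_right)
qed

text \<open>With eps^2 = 0, the inverse of x + d eps is x^{-1} - x^{-1} d x^{-1} eps.\<close>

lemma (in complex_algebra) Units_dual_numbers:
  assumes "fst p \<in> Units A" "snd p \<in> carrier A"
  shows "p \<in> Units (dual_numbers A)"
proof -
  let ?x = "fst p" and ?d = "snd p" and ?y = "inv fst p"
  have c: "?x \<in> carrier A" "?y \<in> carrier A" "?d \<in> carrier A"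
    and inv: "?x \<otimes> ?y = \<one>" "?y \<otimes> ?x = \<one>"
    using assms by auto
  have "?x \<otimes> (\<ominus> (?y \<otimes> ?d \<otimes> ?y)) = \<ominus> ((?x \<otimes> ?y) \<otimes> ?d \<otimes> ?y)"
    using c by algebra
  then have 1: "(?d \<otimes> ?y) \<oplus> (?x \<otimes> (\<ominus> (?y \<otimes> ?d \<otimes> ?y))) = \<zero>"
    using c inv by (simp add: r_neg)
  have "(\<ominus> (?y \<otimes> ?d \<otimes> ?y)) \<otimes> ?x = \<ominus> (?y \<otimes> ?d \<otimes> (?y \<otimes> ?x))"
    using c by algebra
  then have 2: "((\<ominus> (?y \<otimes> ?d \<otimes> ?y)) \<otimes> ?x) \<oplus> (?y \<otimes> ?d) = \<zero>"
    using c inv by (simp add: l_neg)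
  show ?thesis
    unfolding Units_def
    using c inv 1 2
    by (intro CollectI conjI bexI[of _ "(?y, \<ominus> (?y \<otimes> ?d \<otimes> ?y))"]) (simp_all add: mem_Times_iff)
qed

text \<open>One family covers both partial derivatives: weights 1, 0 give \<open>partial_u\<close>
  and weights 0, i give \<open>partial_v\<close>. The entries for \<open>gRi\<close> and
  \<open>gWi\<close> are those that the rule for inverses forces.\<close>

fun weighted_gen :: "real \<Rightarrow> complex \<Rightarrow> complex \<Rightarrow> cat_gen \<Rightarrow> hat" where
  "weighted_gen hbar a b gU = a \<odot>\<^bsub>Hat hbar\<^esub> \<one>\<^bsub>Hat hbar\<^esub>"
| "weighted_gen hbar a b gR = a \<odot>\<^bsub>Hat hbar\<^esub> hgen hbar gR"
| "weighted_gen hbar a b gRi = (- a) \<odot>\<^bsub>Hat hbar\<^esub> hgen hbar gRi"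
| "weighted_gen hbar a b gW = b \<odot>\<^bsub>Hat hbar\<^esub> hgen hbar gW"
| "weighted_gen hbar a b gWi = (- b) \<odot>\<^bsub>Hat hbar\<^esub> hgen hbar gWi"

lemma weighted_gen_closed [simp]: "weighted_gen hbar a b g \<in> carrier (Hat hbar)"
  by (cases g) auto

lemma cat_solution_weighted:
  "cat_solution hbar (dual_numbers (Hat hbar)) (\<lambda>g. (hgen hbar g, weighted_gen hbar a b g))"
  unfolding cat_solution_def Let_def
  by (simp add: image_subset_iff hgen_relations Hat.smult_mult_left Hat.smult_mult_right
      Hat.smult_r_distr Hat.a_ac mult.commute algebra_simps flip: Hat.smult_l_distr)

lemma weighted_derivation_exists:
  obtains d where "derivation (Hat hbar) d" "\<And>g. d (hgen hbar g) = weighted_gen hbar a b g"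
proof -
  have units: "F s \<in> Units (dual_numbers (Hat hbar))"
    if F: "F \<in> algebra_hom (Cat hbar) (dual_numbers (Hat hbar))"
      and gens: "\<And>g. F (cat hbar g) = (hgen hbar g, weighted_gen hbar a b g)"
      and s: "s \<in> Zplus hbar" for F s
  proof -
    note hF = algebra_homD[OF F, simplified] and hi = algebra_homD[OF iota_hom]
    \<comment> \<open>The first component agrees with \<open>iota\<close>, hence is a unit for
      elements of \<open>Zplus\<close>, and \<open>Units_dual_numbers\<close> lifts this to the
      pair.\<close>
    have "fst (F x) = iota hbar x" if "x \<in> ZUR hbar" for x
      using that by (induction rule: ZUR_induct) (simp_all add: hF hi gens iota_cat ZUR_closed)
    moreover have "s \<in> ZUR hbar"
      using s by (simp add: Zplus_def)
    ultimately show ?thesis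
      using iota_Zplus[OF s] hF(1)[OF ZUR_carrier] by (auto intro!: Hat.Units_dual_numbers simp: mem_Times_iff)
  qed
  obtain G where G: "G \<in> algebra_hom (Hat hbar) (dual_numbers (Hat hbar))"
    "\<And>g. G (hgen hbar g) = (hgen hbar g, weighted_gen hbar a b g)"
    by (rule Hat_universal_property[OF Hat.complex_algebra_dual_numbers cat_solution_weighted[of hbar a b]])
      (rule units, assumption+, blast)
  note hG = algebra_homD[OF G(1), simplified]
  have cl: "fst (G x) \<in> carrier (Hat hbar)" "snd (G x) \<in> carrier (Hat hbar)"
    if "x \<in> carrier (Hat hbar)" for x
    using hG(1)[OF that] by (auto simp: mem_Times_iff)
  \<comment> \<open>The first projection is multiplicative and fixes the generators. So
    \<open>G x\<close> is a pair with first entry \<open>x\<close>, and the product of dual numbers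
    becomes Leibniz for the second entry.\<close>
  have fst: "fst (G x) = x" if "x \<in> carrier (Hat hbar)" for x
    using that
  proof (induction rule: Hat_induct)
    case (inverse x y)
    have "fst (G (x \<otimes>\<^bsub>Hat hbar\<^esub> y)) = fst (G x) \<otimes>\<^bsub>Hat hbar\<^esub> fst (G y)"
      using inverse.hyps(1,2) by (simp add: hG)
    then have "x \<otimes>\<^bsub>Hat hbar\<^esub> fst (G y) = \<one>\<^bsub>Hat hbar\<^esub>"
      using inverse by (simp add: hG)
    from Hat.inv_unique[OF inverse.hyps(4) this] show ?case
      using inverse.hyps by (simp add: cl)
  qed (simp_all add: hG G(2))
  have "derivation (Hat hbar) (\<lambda>x. snd (G x))"
    by (auto simp: derivation_def hG cl fst)
  then show thesis
    by (rule that) (simp add: G(2))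
qed

lemma derivation_unique:
  assumes d: "derivation (Hat hbar) d" and e: "derivation (Hat hbar) e"
    and gens: "d (hgen hbar gU) = e (hgen hbar gU)" "d (hgen hbar gR) = e (hgen hbar gR)"
      "d (hgen hbar gW) = e (hgen hbar gW)"
    and "x \<in> carrier (Hat hbar)"
  shows "d x = e x"
  using assms(6)
proof (induction rule: Hat_induct)
  case (inverse x y)
  then show ?case
    by (simp add: Hat.derivation_inverse[OF d inverse.hyps] Hat.derivation_inverse[OF e inverse.hyps])
qed (simp_all add: gens derivationD[OF d] derivationD[OF e] Hat.derivation_one[OF d] Hat.derivation_one[OF e])

section \<open>The pair of partial derivatives: existence and uniqueness\<close>

definition is_partials :: "real \<Rightarrow> (hat \<Rightarrow> hat) \<times> (hat \<Rightarrow> hat) \<Rightarrow> bool" where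
  "is_partials hbar d \<longleftrightarrow> (case d of (du, dv) \<Rightarrow>
     du \<in> extensional (carrier (Hat hbar)) \<and> dv \<in> extensional (carrier (Hat hbar)) \<and>
     derivation (Hat hbar) du \<and> derivation (Hat hbar) dv \<and>
     hermitian_map (Hat hbar) (star hbar) du \<and> hermitian_map (Hat hbar) (star hbar) dv \<and>
     (\<forall>x \<in> carrier (Hat hbar). du (dv x) = dv (du x)) \<and>
     du (hgen hbar gU) = \<one>\<^bsub>Hat hbar\<^esub> \<and> du (hgen hbar gR) = hgen hbar gR \<and> du (hgen hbar gW) = \<zero>\<^bsub>Hat hbar\<^esub> \<and>
     dv (hgen hbar gU) = \<zero>\<^bsub>Hat hbar\<^esub> \<and> dv (hgen hbar gR) = \<zero>\<^bsub>Hat hbar\<^esub> \<and>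
     dv (hgen hbar gW) = \<i> \<odot>\<^bsub>Hat hbar\<^esub> hgen hbar gW)"

text \<open>The conjugated derivation sends U to cnj a and W to (- cnj b) W; the conditions on the
  weights say that these are the original values a and b W.\<close>

lemma weighted_derivation_hermitian:
  assumes d: "derivation (Hat hbar) d" "\<And>g. d (hgen hbar g) = weighted_gen hbar a b g"
    and ab: "cnj a = a" "cnj b = - b"
  shows "hermitian_map (Hat hbar) (star hbar) d"
proof -
  have "star hbar (d (star hbar x)) = d x" if "x \<in> carrier (Hat hbar)" for x
    by (rule derivation_unique[OF Hat.derivation_conjugate[OF d(1) involution_star] d(1) _ _ _ that])
      (simp_all add: star_hgen d(2) star ab)
  then have "star hbar (star hbar (d (star hbar x))) = star hbar (d x)" if "x \<in> carrier (Hat hbar)" for x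
    using that by simp
  then show ?thesis
    by (simp add: hermitian_map_def star derivationD[OF d(1)])
qed

lemma derivation_restrict:
  "derivation (Hat hbar) d \<Longrightarrow> derivation (Hat hbar) (restrict d (carrier (Hat hbar)))"
  by (auto simp: derivation_def)

lemma is_partials_exists: "\<exists>d. is_partials hbar d"
proof -
  obtain d where d: "derivation (Hat hbar) d" "\<And>g. d (hgen hbar g) = weighted_gen hbar 1 0 g"
    using weighted_derivation_exists by blast
  obtain e where e: "derivation (Hat hbar) e" "\<And>g. e (hgen hbar g) = weighted_gen hbar 0 \<i> g"
    using weighted_derivation_exists by blast
  have "d (e x) \<ominus>\<^bsub>Hat hbar\<^esub> e (d x) = \<zero>\<^bsub>Hat hbar\<^esub>" if "x \<in> carrier (Hat hbar)" for x
    by (rule derivation_unique[OF Hat.derivation_commutator[OF d(1) e(1)] Hat.derivation_zero _ _ _ that])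
      (simp_all add: d(2) e(2) derivationD[OF d(1)] derivationD[OF e(1)] Hat.derivation_one[OF d(1)]
        Hat.derivation_one[OF e(1)] Hat.derivation_of_zero[OF d(1)] Hat.derivation_of_zero[OF e(1)]
        a_minus_def)
  then have "d (e x) = e (d x)" if "x \<in> carrier (Hat hbar)" for x
    using that by (simp add: derivationD(1)[OF d(1)] derivationD(1)[OF e(1)])
  moreover have "hermitian_map (Hat hbar) (star hbar) d" "hermitian_map (Hat hbar) (star hbar) e"
    by (rule weighted_derivation_hermitian[OF d] weighted_derivation_hermitian[OF e]; simp)+
  \<comment> \<open>Restriction supplies the extensionality that makes the solution of the
    description unique.\<close>
  ultimately have "is_partials hbar (restrict d (carrier (Hat hbar)), restrict e (carrier (Hat hbar)))"
    using derivation_restrict[OF d(1)] derivation_restrict[OF e(1)]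
    by (simp add: is_partials_def hermitian_map_def star d(2) e(2)
        derivationD(1)[OF d(1)] derivationD(1)[OF e(1)])
  then show ?thesis
    by blast
qed

lemma is_partials_unique:
  assumes "is_partials hbar d" "is_partials hbar e"
  shows "d = e"
proof -
  obtain du dv eu ev where [simp]: "d = (du, dv)" "e = (eu, ev)"
    by fastforce
  have "du x = eu x" "dv x = ev x" if "x \<in> carrier (Hat hbar)" for x
    by (rule derivation_unique[OF _ _ _ _ _ that]; use assms in \<open>simp add: is_partials_def\<close>)+
  then have "du = eu" "dv = ev"
    using assms by (auto simp: is_partials_def intro: extensionalityI[of _ "carrier (Hat hbar)"])
  then show ?thesis
    by simp
qed

lemma is_partials_partials: "is_partials hbar (partial_u hbar, partial_v hbar)"
proof -
  have "\<exists>!d. is_partials hbar d"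
    using is_partials_exists is_partials_unique by blast
  from theI'[OF this] show ?thesis
    by (simp add: partials_def partial_u_def partial_v_def is_partials_def[abs_def])
qed

lemma
  shows derivation_partial_u: "derivation (Hat hbar) (partial_u hbar)"
    and derivation_partial_v: "derivation (Hat hbar) (partial_v hbar)"
    and partial_u_star: "x \<in> carrier (Hat hbar) \<Longrightarrow> partial_u hbar (star hbar x) = star hbar (partial_u hbar x)"
    and partial_v_star: "x \<in> carrier (Hat hbar) \<Longrightarrow> partial_v hbar (star hbar x) = star hbar (partial_v hbar x)"
    and partials_commute: "x \<in> carrier (Hat hbar) \<Longrightarrow>
      partial_u hbar (partial_v hbar x) = partial_v hbar (partial_u hbar x)"
    and partial_u_gen: "partial_u hbar (hgen hbar gU) = \<one>\<^bsub>Hat hbar\<^esub>"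
      "partial_u hbar (hgen hbar gR) = hgen hbar gR" "partial_u hbar (hgen hbar gW) = \<zero>\<^bsub>Hat hbar\<^esub>"
    and partial_v_gen: "partial_v hbar (hgen hbar gU) = \<zero>\<^bsub>Hat hbar\<^esub>"
      "partial_v hbar (hgen hbar gR) = \<zero>\<^bsub>Hat hbar\<^esub>"
      "partial_v hbar (hgen hbar gW) = \<i> \<odot>\<^bsub>Hat hbar\<^esub> hgen hbar gW"
  using is_partials_partials[of hbar] by (simp_all add: is_partials_def hermitian_map_def)

lemmas partial_u = derivationD[OF derivation_partial_u] Hat.derivation_one[OF derivation_partial_u] Hat.derivation_of_zero[OF derivation_partial_u]
  partial_u_gen
lemmas partial_v = derivationD[OF derivation_partial_v] Hat.derivation_one[OF derivation_partial_v] Hat.derivation_of_zero[OF derivation_partial_v]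
  partial_v_gen

lemma partial_u_inverses:
  "partial_u hbar (hgen hbar gRi) = (-1) \<odot>\<^bsub>Hat hbar\<^esub> hgen hbar gRi"
  "partial_u hbar (hgen hbar gWi) = \<zero>\<^bsub>Hat hbar\<^esub>"
  by (simp_all add: Hat.derivation_inverse[OF derivation_partial_u hgen_closed hgen_closed R_Ri Ri_R]
      Hat.derivation_inverse[OF derivation_partial_u hgen_closed hgen_closed W_Wi Wi_W]
      partial_u_gen Ri_R Hat.uminus_eq_smult)

lemma partial_v_inverses:
  "partial_v hbar (hgen hbar gRi) = \<zero>\<^bsub>Hat hbar\<^esub>"
  "partial_v hbar (hgen hbar gWi) = (- \<i>) \<odot>\<^bsub>Hat hbar\<^esub> hgen hbar gWi"
  by (simp_all add: Hat.derivation_inverse[OF derivation_partial_v hgen_closed hgen_closed R_Ri Ri_R]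
      Hat.derivation_inverse[OF derivation_partial_v hgen_closed hgen_closed W_Wi Wi_W]
      partial_v_gen Wi_W Hat.uminus_eq_smult Hat.smult_mult_left Hat.smult_mult_right)

section \<open>The Laplace operator\<close>

lemma R_W_components [simp]:
  "RW hbar \<in> carrier (Hat hbar)" "RiWi hbar \<in> carrier (Hat hbar)"
  by (simp_all add: RW_def RiWi_def)

lemma Phi_components:
  "Phi hbar $ 1 = (1/2 * of_real (exp (hbar/2))) \<odot>\<^bsub>Hat hbar\<^esub> (RW hbar \<ominus>\<^bsub>Hat hbar\<^esub> RiWi hbar)"
  "Phi hbar $ 2 = (- \<i>/2 * of_real (exp (hbar/2))) \<odot>\<^bsub>Hat hbar\<^esub> (RW hbar \<oplus>\<^bsub>Hat hbar\<^esub> RiWi hbar)"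
  "Phi hbar $ 3 = \<one>\<^bsub>Hat hbar\<^esub>"
  by (simp_all add: Phi_def)

lemma Phi_closed [simp]:
  "Phi hbar $ i \<in> carrier (Hat hbar)" "Phibar hbar $ i \<in> carrier (Hat hbar)"
  by (simp_all add: Phibar_def star(1) Phi_def)

section \<open>Linear independence of Phi and its conjugate\<close>

lemma star_uminus: "x \<in> carrier (Hat hbar) \<Longrightarrow> star hbar (\<ominus>\<^bsub>Hat hbar\<^esub> x) = \<ominus>\<^bsub>Hat hbar\<^esub> star hbar x"
  by (simp add: Hat.uminus_eq_smult star)

text \<open>\<open>phi\<close> sends the corresponding element of \<open>ZUR\<close> to e^u +
  e^{-hbar} e^{-u}, a sum of positive terms.\<close>

lemma R_plus_Ri_unit:
  "hgen hbar gR \<oplus>\<^bsub>Hat hbar\<^esub> of_real (exp (- hbar)) \<odot>\<^bsub>Hat hbar\<^esub> hgen hbar gRi \<in> Units (Hat hbar)"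
proof -
  let ?s = "cat hbar gR \<oplus>\<^bsub>Cat hbar\<^esub> of_real (exp (- hbar)) \<odot>\<^bsub>Cat hbar\<^esub> cat hbar gRi"
  have Z: "?s \<in> ZUR hbar"
    by (intro ZUR_add ZUR_smult ZUR_gen) auto
  have "phi hbar ?s = (\<lambda>u. of_real (exp u + exp (- hbar) * exp (- u)))"
    by (simp add: phi_hom phi_gen ZUR_gen ZUR_smult)
  moreover have "exp u + exp (- hbar) * exp (- u) \<noteq> 0" for u
    using add_pos_pos[of "exp u" "exp (- hbar) * exp (- u)"] by simp
  ultimately have "?s \<in> Zplus hbar"
    using Z by (simp add: Zplus_def del: of_real_add of_real_mult)
  from iota_Zplus[OF this] show ?thesis
    by (simp add: algebra_homD[OF iota_hom] iota_cat)
qed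

text \<open>If \<open>(x, -x)\<close> annihilates \<open>(\<Phi>, \<Phi>bar)\<close>, then the first two components give
  \<open>(R W + (R\<^sup>-\<^sup>1 W\<^sup>-\<^sup>1)\<^sup>*) x = 0\<close>, and \<open>R W + W R\<^sup>-\<^sup>1 = (R + e\<^sup>-\<^sup>h R\<^sup>-\<^sup>1) W\<close> is invertible.\<close>

lemma Phi_independent:
  assumes x: "x \<in> carrier (Hat hbar)" and y: "y \<in> carrier (Hat hbar)"
    and eq: "\<And>i. (Phi hbar $ i \<otimes>\<^bsub>Hat hbar\<^esub> x) \<oplus>\<^bsub>Hat hbar\<^esub> (Phibar hbar $ i \<otimes>\<^bsub>Hat hbar\<^esub> y) = \<zero>\<^bsub>Hat hbar\<^esub>"
  shows "x = \<zero>\<^bsub>Hat hbar\<^esub> \<and> y = \<zero>\<^bsub>Hat hbar\<^esub>"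
proof -
  let ?H = "Hat hbar" and ?A = "RW hbar" and ?B = "RiWi hbar"
  let ?A' = "star hbar (RW hbar)" and ?B' = "star hbar (RiWi hbar)"
  define k where "k = 1/2 * complex_of_real (exp (hbar/2))"
  have k: "k \<noteq> 0" "cnj k = k"
    by (simp_all add: k_def)
  note c = x y R_W_components[of hbar] star(1)[OF R_W_components(1)] star(1)[OF R_W_components(2)]
  \<comment> \<open>The third component of both vectors is the unit.\<close>
  have "x \<oplus>\<^bsub>?H\<^esub> y = \<zero>\<^bsub>?H\<^esub>"
    using eq[of 3] x y by (simp add: Phibar_def Phi_components star)
  then have y_eq: "y = \<ominus>\<^bsub>?H\<^esub> x"
    using x y by (metis Hat.a_comm Hat.minus_equality)
  have diff: "(Phi hbar $ i \<ominus>\<^bsub>?H\<^esub> Phibar hbar $ i) \<otimes>\<^bsub>?H\<^esub> x = \<zero>\<^bsub>?H\<^esub>" for i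
  proof -
    have "(P \<ominus>\<^bsub>?H\<^esub> Q) \<otimes>\<^bsub>?H\<^esub> x = (P \<otimes>\<^bsub>?H\<^esub> x) \<oplus>\<^bsub>?H\<^esub> (Q \<otimes>\<^bsub>?H\<^esub> (\<ominus>\<^bsub>?H\<^esub> x))"
      if "P \<in> carrier ?H" "Q \<in> carrier ?H" for P Q
      using that x by (simp add: a_minus_def Hat.l_distr Hat.l_minus Hat.r_minus)
    then show ?thesis
      using eq[of i] by (simp add: y_eq)
  qed
  have cancel: "P \<otimes>\<^bsub>?H\<^esub> x = \<zero>\<^bsub>?H\<^esub>"
    if P: "P \<in> carrier ?H" and "l \<noteq> 0" and z: "(l \<odot>\<^bsub>?H\<^esub> P) \<otimes>\<^bsub>?H\<^esub> x = \<zero>\<^bsub>?H\<^esub>" for P l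
  proof -
    have "P \<otimes>\<^bsub>?H\<^esub> x = (1 / l) \<odot>\<^bsub>?H\<^esub> ((l \<odot>\<^bsub>?H\<^esub> P) \<otimes>\<^bsub>?H\<^esub> x)"
      using P x \<open>l \<noteq> 0\<close> by (simp add: Hat.smult_mult_left)
    then show ?thesis
      by (simp add: z)
  qed
  have Phibar1: "Phibar hbar $ 1 = k \<odot>\<^bsub>?H\<^esub> (?A' \<ominus>\<^bsub>?H\<^esub> ?B')"
    unfolding Phibar_def vec_lambda_beta Phi_components k_def[symmetric]
    by (simp add: star(2,4) star_uminus a_minus_def k(2))
  have smult_diff: "l \<odot>\<^bsub>?H\<^esub> P \<ominus>\<^bsub>?H\<^esub> l \<odot>\<^bsub>?H\<^esub> Q = l \<odot>\<^bsub>?H\<^esub> (P \<ominus>\<^bsub>?H\<^esub> Q)"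
    if "P \<in> carrier ?H" "Q \<in> carrier ?H" for l P Q
    using that by (simp add: a_minus_def Hat.smult_r_distr Hat.smult_minus_right)
  have diff1: "Phi hbar $ 1 \<ominus>\<^bsub>?H\<^esub> Phibar hbar $ 1 = k \<odot>\<^bsub>?H\<^esub> ((?A \<ominus>\<^bsub>?H\<^esub> ?B) \<ominus>\<^bsub>?H\<^esub> (?A' \<ominus>\<^bsub>?H\<^esub> ?B'))"
    unfolding Phibar1 Phi_components k_def[symmetric]
    by (rule smult_diff) (simp_all add: star(1))
  have 1: "((?A \<ominus>\<^bsub>?H\<^esub> ?B) \<ominus>\<^bsub>?H\<^esub> (?A' \<ominus>\<^bsub>?H\<^esub> ?B')) \<otimes>\<^bsub>?H\<^esub> x = \<zero>\<^bsub>?H\<^esub>"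
    by (rule cancel[OF _ k(1) diff[of 1, unfolded diff1]]) (simp add: star(1))
  have ik: "- \<i>/2 * complex_of_real (exp (hbar/2)) = - \<i> * k"
    by (simp add: k_def)
  \<comment> \<open>Conjugation turns -i k into i k, so in the second component subtracting the
    conjugate vector adds the starred terms, unlike in the first.\<close>
  have Phibar2: "Phibar hbar $ 2 = (\<i> * k) \<odot>\<^bsub>?H\<^esub> (?A' \<oplus>\<^bsub>?H\<^esub> ?B')"
    unfolding Phibar_def vec_lambda_beta Phi_components ik by (simp add: star(2,4) k(2))
  have smult_diff_neg: "(- l) \<odot>\<^bsub>?H\<^esub> P \<ominus>\<^bsub>?H\<^esub> l \<odot>\<^bsub>?H\<^esub> Q = (- l) \<odot>\<^bsub>?H\<^esub> (P \<oplus>\<^bsub>?H\<^esub> Q)"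
    if "P \<in> carrier ?H" "Q \<in> carrier ?H" for l P Q
    unfolding Hat.smult_r_distr[OF that] a_minus_def Hat.smult_uminus[OF that(2)] ..
  have diff2: "Phi hbar $ 2 \<ominus>\<^bsub>?H\<^esub> Phibar hbar $ 2 = (- \<i> * k) \<odot>\<^bsub>?H\<^esub> ((?A \<oplus>\<^bsub>?H\<^esub> ?B) \<oplus>\<^bsub>?H\<^esub> (?A' \<oplus>\<^bsub>?H\<^esub> ?B'))"
    unfolding Phibar2 Phi_components ik mult_minus_left
    by (rule smult_diff_neg) (simp_all add: star(1))
  have 2: "((?A \<oplus>\<^bsub>?H\<^esub> ?B) \<oplus>\<^bsub>?H\<^esub> (?A' \<oplus>\<^bsub>?H\<^esub> ?B')) \<otimes>\<^bsub>?H\<^esub> x = \<zero>\<^bsub>?H\<^esub>"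
    by (rule cancel[OF _ _ diff[of 2, unfolded diff2]]) (simp_all add: star(1) k(1))
  \<comment> \<open>The factor 2 is written as a repeated summand, so that the next identity uses
    ring operations only.\<close>
  have double: "2 \<odot>\<^bsub>?H\<^esub> (?A \<oplus>\<^bsub>?H\<^esub> ?B') = (?A \<oplus>\<^bsub>?H\<^esub> ?B') \<oplus>\<^bsub>?H\<^esub> (?A \<oplus>\<^bsub>?H\<^esub> ?B')"
    using Hat.smult_l_distr[of "?A \<oplus>\<^bsub>?H\<^esub> ?B'" hbar 1 1] c by simp
  \<comment> \<open>Adding the two annihilation identities removes \<open>?B\<close> and
    \<open>?A'\<close> and doubles \<open>?A\<close> and \<open>?B'\<close>.\<close>
  have "((?A \<oplus>\<^bsub>?H\<^esub> ?B') \<oplus>\<^bsub>?H\<^esub> (?A \<oplus>\<^bsub>?H\<^esub> ?B')) \<otimes>\<^bsub>?H\<^esub> x = (((?A \<ominus>\<^bsub>?H\<^esub> ?B) \<ominus>\<^bsub>?H\<^esub> (?A' \<ominus>\<^bsub>?H\<^esub> ?B')) \<otimes>\<^bsub>?H\<^esub> x) \<oplus>\<^bsub>?H\<^esub>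
      (((?A \<oplus>\<^bsub>?H\<^esub> ?B) \<oplus>\<^bsub>?H\<^esub> (?A' \<oplus>\<^bsub>?H\<^esub> ?B')) \<otimes>\<^bsub>?H\<^esub> x)"
    using c by algebra
  then have "(2 \<odot>\<^bsub>?H\<^esub> (?A \<oplus>\<^bsub>?H\<^esub> ?B')) \<otimes>\<^bsub>?H\<^esub> x = \<zero>\<^bsub>?H\<^esub>"
    unfolding double 1 2 by simp
  then have "(?A \<oplus>\<^bsub>?H\<^esub> ?B') \<otimes>\<^bsub>?H\<^esub> x = \<zero>\<^bsub>?H\<^esub>"
    by (rule cancel[rotated 2]) (use c in simp_all)
  moreover define N where
    "N = hgen hbar gR \<oplus>\<^bsub>?H\<^esub> of_real (exp (- hbar)) \<odot>\<^bsub>?H\<^esub> hgen hbar gRi"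
  have "?A \<oplus>\<^bsub>?H\<^esub> ?B' = N \<otimes>\<^bsub>?H\<^esub> hgen hbar gW"
    by (simp add: RW_def RiWi_def N_def star star_hgen W_Ri Hat.l_distr Hat.smult_mult_left)
  moreover have "N \<in> Units ?H" "hgen hbar gW \<in> Units ?H"
    using R_plus_Ri_unit W_Wi Wi_W by (auto simp: N_def Units_def intro!: bexI[of _ "hgen hbar gWi"])
  then have "N \<otimes>\<^bsub>?H\<^esub> hgen hbar gW \<in> Units ?H" "N \<in> carrier ?H"
    by auto
  ultimately have "x = \<zero>\<^bsub>?H\<^esub>"
    using x Hat.Units_l_cancel[of "N \<otimes>\<^bsub>?H\<^esub> hgen hbar gW" hbar x "\<zero>\<^bsub>?H\<^esub>"] by simp
  then show ?thesis
    by (simp add: y_eq)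
qed

lemma combination_inject:
  assumes c: "a \<in> carrier (Hat hbar)" "b \<in> carrier (Hat hbar)" "a' \<in> carrier (Hat hbar)" "b' \<in> carrier (Hat hbar)"
    and eq: "combination hbar a b = combination hbar a' b'"
  shows "a = a' \<and> b = b'"
proof -
  have "(Phi hbar $ i \<otimes>\<^bsub>Hat hbar\<^esub> (a \<ominus>\<^bsub>Hat hbar\<^esub> a')) \<oplus>\<^bsub>Hat hbar\<^esub>
      (Phibar hbar $ i \<otimes>\<^bsub>Hat hbar\<^esub> (b \<ominus>\<^bsub>Hat hbar\<^esub> b')) = \<zero>\<^bsub>Hat hbar\<^esub>" for i
  proof -
    let ?P = "Phi hbar $ i" and ?Q = "Phibar hbar $ i"
    have e: "(?P \<otimes>\<^bsub>Hat hbar\<^esub> a) \<oplus>\<^bsub>Hat hbar\<^esub> (?Q \<otimes>\<^bsub>Hat hbar\<^esub> b) =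
        (?P \<otimes>\<^bsub>Hat hbar\<^esub> a') \<oplus>\<^bsub>Hat hbar\<^esub> (?Q \<otimes>\<^bsub>Hat hbar\<^esub> b')"
      using arg_cong[OF eq, of "\<lambda>X. X $ i"] by (simp add: combination_def vadd_def vright_def)
    note PQ = Phi_closed[of hbar i]
    have "(?P \<otimes>\<^bsub>Hat hbar\<^esub> (a \<ominus>\<^bsub>Hat hbar\<^esub> a')) \<oplus>\<^bsub>Hat hbar\<^esub> (?Q \<otimes>\<^bsub>Hat hbar\<^esub> (b \<ominus>\<^bsub>Hat hbar\<^esub> b')) =
      ((?P \<otimes>\<^bsub>Hat hbar\<^esub> a) \<oplus>\<^bsub>Hat hbar\<^esub> (?Q \<otimes>\<^bsub>Hat hbar\<^esub> b)) \<ominus>\<^bsub>Hat hbar\<^esub>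
      ((?P \<otimes>\<^bsub>Hat hbar\<^esub> a') \<oplus>\<^bsub>Hat hbar\<^esub> (?Q \<otimes>\<^bsub>Hat hbar\<^esub> b'))"
      using PQ c by algebra
    also have "\<dots> = \<zero>\<^bsub>Hat hbar\<^esub>"
      unfolding e using PQ c by simp
    finally show ?thesis .
  qed
  from Phi_independent[OF _ _ this] show ?thesis
    using c by simp
qed

lemma coords_combination:
  assumes "a \<in> carrier (Hat hbar)" "b \<in> carrier (Hat hbar)"
  shows "coords hbar (combination hbar a b) = (a, b)"
  unfolding coords_def
proof (rule the_equality)
  fix ab assume ab: "ab \<in> carrier (Hat hbar) \<times> carrier (Hat hbar) \<and>
    combination hbar a b = combination hbar (fst ab) (snd ab)"
  then have "a = fst ab \<and> b = snd ab"
    using assms by (intro combination_inject[of _ hbar]) auto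
  then show "ab = (a, b)"
    by simp
qed (use assms in simp)

section \<open>Second-order operators and harmonic elements\<close>

lemma del_closed [simp]:
  "f \<in> carrier (Hat hbar) \<Longrightarrow> del hbar f \<in> carrier (Hat hbar)"
  "f \<in> carrier (Hat hbar) \<Longrightarrow> delbar hbar f \<in> carrier (Hat hbar)"
  by (simp_all add: del_def delbar_def partial_u(1) partial_v(1))

definition flat_laplacian :: "real \<Rightarrow> hat \<Rightarrow> hat" where
  "flat_laplacian hbar f = partial_u hbar (partial_u hbar f) \<oplus>\<^bsub>Hat hbar\<^esub> partial_v hbar (partial_v hbar f)"

lemma del_delbar:
  assumes "f \<in> carrier (Hat hbar)"
  shows "del hbar (delbar hbar f) = (1/4) \<odot>\<^bsub>Hat hbar\<^esub> flat_laplacian hbar f"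
    and "delbar hbar (del hbar f) = (1/4) \<odot>\<^bsub>Hat hbar\<^esub> flat_laplacian hbar f"
proof -
  let ?H = "Hat hbar"
  let ?uu = "partial_u hbar (partial_u hbar f)" and ?vv = "partial_v hbar (partial_v hbar f)"
    and ?vu = "partial_v hbar (partial_u hbar f)"
  have c: "?uu \<in> carrier ?H" "?vv \<in> carrier ?H" "?vu \<in> carrier ?H"
    using assms by (simp_all add: partial_u(1) partial_v(1))
  \<comment> \<open>The mixed derivatives appear with coefficients i/4 and -i/4;
    \<open>partials_commute\<close> brings both to the same form, so they cancel.\<close>
  have "del hbar (delbar hbar f) = ((1/4) \<odot>\<^bsub>?H\<^esub> ?uu \<oplus>\<^bsub>?H\<^esub> (1/4) \<odot>\<^bsub>?H\<^esub> ?vv) \<oplus>\<^bsub>?H\<^esub>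
      ((\<i>/4) \<odot>\<^bsub>?H\<^esub> ?vu \<ominus>\<^bsub>?H\<^esub> (\<i>/4) \<odot>\<^bsub>?H\<^esub> ?vu)"
    using assms c
    by (simp add: del_def delbar_def partial_u(1-3) partial_v(1-3) partials_commute a_minus_def
        Hat.uminus_eq_smult Hat.smult_r_distr Hat.a_ac)
  then show "del hbar (delbar hbar f) = (1/4) \<odot>\<^bsub>?H\<^esub> flat_laplacian hbar f"
    using c by (simp add: flat_laplacian_def Hat.smult_r_distr)
  have "delbar hbar (del hbar f) = ((1/4) \<odot>\<^bsub>?H\<^esub> ?uu \<oplus>\<^bsub>?H\<^esub> (1/4) \<odot>\<^bsub>?H\<^esub> ?vv) \<oplus>\<^bsub>?H\<^esub>
      ((\<i>/4) \<odot>\<^bsub>?H\<^esub> ?vu \<ominus>\<^bsub>?H\<^esub> (\<i>/4) \<odot>\<^bsub>?H\<^esub> ?vu)"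
    using assms c
    by (simp add: del_def delbar_def partial_u(1-3) partial_v(1-3) partials_commute a_minus_def
        Hat.uminus_eq_smult Hat.smult_r_distr Hat.a_ac)
  then show "delbar hbar (del hbar f) = (1/4) \<odot>\<^bsub>?H\<^esub> flat_laplacian hbar f"
    using c by (simp add: flat_laplacian_def Hat.smult_r_distr)
qed

lemma Laplace_eq_zero:
  assumes S: "S \<in> Units (Hat hbar)" and T: "T \<in> Units (Hat hbar)"
    and f: "f \<in> carrier (Hat hbar)" and harmonic: "flat_laplacian hbar f = \<zero>\<^bsub>Hat hbar\<^esub>"
  shows "Laplace hbar S T f = \<zero>\<^bsub>Hat hbar\<^esub>"
proof -
  let ?H = "Hat hbar"
  have cancel: "V \<otimes>\<^bsub>?H\<^esub> (inv\<^bsub>?H\<^esub> V \<otimes>\<^bsub>?H\<^esub> x) = x" if "V \<in> Units ?H" "x \<in> carrier ?H" for V x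
    using that Hat.m_assoc[of V hbar "inv\<^bsub>?H\<^esub> V" x] by (simp add: Hat.Units_closed)
  \<comment> \<open>Independence of \<open>Phi\<close> and \<open>Phibar\<close> enters here: the
    coordinates of the gradient are its two coefficients.\<close>
  have "coords hbar (gradient hbar S T f) = (inv\<^bsub>?H\<^esub> S \<otimes>\<^bsub>?H\<^esub> delbar hbar f, inv\<^bsub>?H\<^esub> T \<otimes>\<^bsub>?H\<^esub> del hbar f)"
    using S T f by (simp add: gradient_def coords_combination)
  then show ?thesis
    using S T f by (simp add: Laplace_def divergence_def cancel del_delbar harmonic)
qed

lemma flat_laplacian_add:
  assumes "f \<in> carrier (Hat hbar)" "g \<in> carrier (Hat hbar)"
  shows "flat_laplacian hbar (f \<oplus>\<^bsub>Hat hbar\<^esub> g) = flat_laplacian hbar f \<oplus>\<^bsub>Hat hbar\<^esub> flat_laplacian hbar g"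
  using assms by (simp add: flat_laplacian_def partial_u(1,2) partial_v(1,2) Hat.a_ac)

lemma flat_laplacian_smult:
  assumes "f \<in> carrier (Hat hbar)"
  shows "flat_laplacian hbar (c \<odot>\<^bsub>Hat hbar\<^esub> f) = c \<odot>\<^bsub>Hat hbar\<^esub> flat_laplacian hbar f"
  using assms by (simp add: flat_laplacian_def partial_u(1,3) partial_v(1,3) Hat.smult_r_distr)

text \<open>Both partial derivatives are hermitian, so adjoints of harmonic elements are
  harmonic.\<close>

lemma flat_laplacian_star:
  assumes "f \<in> carrier (Hat hbar)"
  shows "flat_laplacian hbar (star hbar f) = star hbar (flat_laplacian hbar f)"
  using assms by (simp add: flat_laplacian_def partial_u(1) partial_v(1) partial_u_star partial_v_star star(2))

lemma flat_laplacian_U: "flat_laplacian hbar (hgen hbar gU) = \<zero>\<^bsub>Hat hbar\<^esub>"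
  by (simp add: flat_laplacian_def partial_u partial_v)

text \<open>R W is an eigenvector with eigenvalue 1 for \<open>partial_u\<close> and i for
  \<open>partial_v\<close>, and 1 + i^2 = 0.\<close>

lemma flat_laplacian_RW: "flat_laplacian hbar (RW hbar) = \<zero>\<^bsub>Hat hbar\<^esub>"
proof -
  have "partial_u hbar (partial_u hbar (RW hbar)) = RW hbar"
    "partial_v hbar (partial_v hbar (RW hbar)) = (-1) \<odot>\<^bsub>Hat hbar\<^esub> RW hbar"
    by (simp_all add: RW_def partial_u partial_v Hat.smult_mult_right)
  then show ?thesis
    by (simp add: flat_laplacian_def Hat.smult_uminus Hat.r_neg)
qed

text \<open>The eigenvalues are now -1 and -i, with the same squares.\<close>

lemma flat_laplacian_RiWi: "flat_laplacian hbar (RiWi hbar) = \<zero>\<^bsub>Hat hbar\<^esub>"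
proof -
  have "partial_u hbar (partial_u hbar (RiWi hbar)) = RiWi hbar"
    "partial_v hbar (partial_v hbar (RiWi hbar)) = (-1) \<odot>\<^bsub>Hat hbar\<^esub> RiWi hbar"
    by (simp_all add: RiWi_def partial_u partial_v partial_u_inverses partial_v_inverses
        Hat.smult_mult_left Hat.smult_mult_right)
  then show ?thesis
    by (simp add: flat_laplacian_def Hat.smult_uminus Hat.r_neg)
qed

theorem mainTheorem3:
  fixes hbar :: real and S T :: hat and h :: "hat^3 \<Rightarrow> hat^3 \<Rightarrow> hat"
  assumes "S \<in> Units (Hat hbar)" and "T \<in> Units (Hat hbar)"
    and "hermitian_form hbar h"
    and "h (Phi hbar) (Phi hbar) = S"
    and "h (Phibar hbar) (Phibar hbar) = T"
    and "h (Phi hbar) (Phibar hbar) = \<zero>\<^bsub>Hat hbar\<^esub>"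
  shows "Laplace hbar S T (X1 hbar) = \<zero>\<^bsub>Hat hbar\<^esub> \<and>
         Laplace hbar S T (X2 hbar) = \<zero>\<^bsub>Hat hbar\<^esub> \<and>
         Laplace hbar S T (X3 hbar) = \<zero>\<^bsub>Hat hbar\<^esub>"
proof (intro conjI; rule Laplace_eq_zero[OF assms(1,2)])
  note [simp] = star(1)
  \<comment> \<open>Zero is its own multiple by the scalar 0, so antilinearity gives its
    image.\<close>
  have star_zero: "star hbar \<zero>\<^bsub>Hat hbar\<^esub> = \<zero>\<^bsub>Hat hbar\<^esub>"
    using star(4)[of "\<zero>\<^bsub>Hat hbar\<^esub>" hbar 0] by simp
  show "X1 hbar \<in> carrier (Hat hbar)" "X2 hbar \<in> carrier (Hat hbar)" "X3 hbar \<in> carrier (Hat hbar)"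
    by (simp_all add: X1_def X2_def X3_def)
  show "flat_laplacian hbar (X1 hbar) = \<zero>\<^bsub>Hat hbar\<^esub>"
    "flat_laplacian hbar (X2 hbar) = \<zero>\<^bsub>Hat hbar\<^esub>"
    \<comment> \<open>Both elements are complex linear combinations of \<open>RW\<close>,
      \<open>RiWi\<close> and their adjoints, each of which the operator annihilates.\<close>
    by (simp_all add: X1_def X2_def a_minus_def Hat.uminus_eq_smult flat_laplacian_add
        flat_laplacian_smult flat_laplacian_star flat_laplacian_RW flat_laplacian_RiWi star_zero)
  show "flat_laplacian hbar (X3 hbar) = \<zero>\<^bsub>Hat hbar\<^esub>"
    by (simp add: X3_def flat_laplacian_U)
qed

end
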